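(* Let $G$ be a finite chordal graph, i.e. a finite simple undirected graph in which every cycle of length greater than three has a chord. Then $\mathcal{H}^{\mathrm{Path}}_n(G)\cong\mathcal{H}^{\mathrm{Cube}}_n(G)\cong(0)$ for all $n>0$.
   Context: $R$ is a commutative ring with unit; graphs are finite, simple and undirected. A graph homomorphism is a vertex map sending adjacent vertices to equal or adjacent vertices. $Q_n$ is the graph on $\{0,1\}^n$ with edges between vertices at Hamming distance one ($Q_0$ a single vertex). Discrete cubical homology $\mathcal{H}^{\mathrm{Cube}}_\bullet(G)$: a singular $n$-cube is a graph homomorphism $\sigma: Q_n\to G$; $\mathcal{L}^{\mathrm{Cube}}_n(G)$ is the free $R$-module on them. For $n\ge1$, $i\in[n]$: $f_i^{\pm}\sigma(a_1,\dots,a_{n-1})=\sigma(a_1,\dots,a_{i-1},\epsilon,a_i,\dots,a_{n-1})$ with $\epsilon=1$ for $+$, $\epsilon=0$ for $-$. $\sigma$ is degenerate if $f_i^+\sigma=f_i^-\sigma$ for some $i$. $\mathcal{C}^{\mathrm{Cube}}_n(G)$ is $\mathcal{L}^{\mathrm{Cube}}_n(G)$ modulo degenerate cubes, with $\partial_n\sigma=\sum_{i=1}^n(-1)^i(f_i^-\sigma-f_i^+\sigma)$, $\partial_0=0$; $\mathcal{H}^{\mathrm{Cube}}_n(G)$ is its homology. Path homology $\mathcal{H}^{\mathrm{Path}}_\bullet(G)$: $\mathcal{C}_n(V)$ is the free $R$-module on $(n+1)$-tuples of vertices modulo tuples with $v_i=v_{i+1}$ for some $i$, with $\partial_n(v_0,\dots,v_n)=\sum_{i=0}^n(-1)^i(v_0,\dots,\widehat{v_i},\dots,v_n)$,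 $\partial_0=0$. $\widetilde{\mathcal{C}}_n(G)\subseteq\mathcal{C}_n(V)$ is generated by allowed paths (tuples with $\{v_i,v_{i+1}\}\in E(G)$ for all $i$), $\widetilde{\mathcal{C}}_{-1}=0$; $\mathcal{C}^{\mathrm{Path}}_n(G)=\{x\in\widetilde{\mathcal{C}}_n(G):\partial_nx\in\widetilde{\mathcal{C}}_{n-1}(G)\}$ and $\mathcal{H}^{\mathrm{Path}}_n(G)$ is its homology. *)

theory Defs
  imports
    "HOL-Algebra.AbelCoset"
    "HOL-Algebra.Module"
    "HOL-Library.FuncSet"
    "HOL-Library.Poly_Mapping"
    "Graph_Theory.Graph_Theory"
begin

section \<open>Modules\<close>

text \<open>
  Coefficients live in a type of sort \<open>{comm_ring, comm_monoid_mult}\<close>: a commutative ring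
  with unit in which, unlike in class \<open>comm_ring_1\<close>, \<open>0 = 1\<close> is not excluded.
  Modules are records of HOL-Algebra; the fields \<open>mult\<close> and \<open>one\<close>, which these records
  inherit from rings, play no role and are filled with a dummy value.
\<close>

definition scale :: "'r::{comm_ring,comm_monoid_mult} \<Rightarrow> ('a \<Rightarrow>\<^sub>0 'r) \<Rightarrow> ('a \<Rightarrow>\<^sub>0 'r)" where
  "scale r c = Poly_Mapping.map (\<lambda>s. r * s) c"

definition free_module :: "'a set \<Rightarrow> ('r::{comm_ring,comm_monoid_mult}, 'a \<Rightarrow>\<^sub>0 'r) module" where
  "free_module S =
    \<lparr>carrier = {c. Poly_Mapping.keys c \<subseteq> S}, monoid.mult = undefined, one = undefined,
     zero = 0, add = (+), smult = scale\<rparr>"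

definition linear_extension ::
  "('a \<Rightarrow> ('b \<Rightarrow>\<^sub>0 'r)) \<Rightarrow> ('a \<Rightarrow>\<^sub>0 'r) \<Rightarrow> ('b \<Rightarrow>\<^sub>0 'r::{comm_ring,comm_monoid_mult})" where
  "linear_extension g c = (\<Sum>x\<in>Poly_Mapping.keys c. scale (Poly_Mapping.lookup c x) (g x))"

definition quotient_module :: "('r, 'm) module \<Rightarrow> 'm set \<Rightarrow> ('r, 'm set) module" where
  "quotient_module M N =
    \<lparr>carrier = a_rcosets\<^bsub>M\<^esub> N, monoid.mult = undefined, one = undefined,
     zero = N, add = set_add M, smult = (\<lambda>r X. \<Union>x\<in>X. N +>\<^bsub>M\<^esub> (r \<odot>\<^bsub>M\<^esub> x))\<rparr>"

text \<open>The map on cosets, with values in the quotient of \<open>M\<close> by \<open>N\<close>, induced by \<open>f\<close>.\<close>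

definition induced_map :: "('r, 'm) module \<Rightarrow> 'm set \<Rightarrow> ('l \<Rightarrow> 'm) \<Rightarrow> 'l set \<Rightarrow> 'm set" where
  "induced_map M N f X = (\<Union>x\<in>X. N +>\<^bsub>M\<^esub> f x)"

definition zero_module :: "('r, unit) module" where
  "zero_module = \<lparr>carrier = {()}, monoid.mult = undefined, one = undefined,
     zero = (), add = (\<lambda>_ _. ()), smult = (\<lambda>_ _. ())\<rparr>"

definition module_isomorphic :: "('r, 'm) module \<Rightarrow> ('r, 'l) module \<Rightarrow> bool" where
  "module_isomorphic M N \<longleftrightarrow>
    (\<exists>h. bij_betw h (carrier M) (carrier N) \<and>
      (\<forall>x\<in>carrier M. \<forall>y\<in>carrier M. h (x \<oplus>\<^bsub>M\<^esub> y) = h x \<oplus>\<^bsub>N\<^esub> h y) \<and>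
      (\<forall>r. \<forall>x\<in>carrier M. h (r \<odot>\<^bsub>M\<^esub> x) = r \<odot>\<^bsub>N\<^esub> h x))"

text \<open>
  A chain complex consists of modules \<open>C n\<close> and maps \<open>d n\<close> from \<open>C n\<close> to \<open>C (n - 1)\<close>.
  As \<open>0 - 1 = 0\<close> on the natural numbers, \<open>d 0\<close> formally lands in \<open>C 0\<close>; below it is
  always the zero map, so that every element of \<open>C 0\<close> is a cycle.
\<close>

definition cycles :: "(nat \<Rightarrow> ('r, 'm) module) \<Rightarrow> (nat \<Rightarrow> 'm \<Rightarrow> 'm) \<Rightarrow> nat \<Rightarrow> 'm set" where
  "cycles C d n = {x \<in> carrier (C n). d n x = \<zero>\<^bsub>C (n - 1)\<^esub>}"

definition boundaries :: "(nat \<Rightarrow> ('r, 'm) module) \<Rightarrow> (nat \<Rightarrow> 'm \<Rightarrow> 'm) \<Rightarrow> nat \<Rightarrow> 'm set" where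
  "boundaries C d n = d (Suc n) ` carrier (C (Suc n))"

definition homology ::
  "(nat \<Rightarrow> ('r, 'm) module) \<Rightarrow> (nat \<Rightarrow> 'm \<Rightarrow> 'm) \<Rightarrow> nat \<Rightarrow> ('r, 'm set) module" where
  "homology C d n = quotient_module ((C n)\<lparr>carrier := cycles C d n\<rparr>) (boundaries C d n)"


section \<open>Graphs\<close>

text \<open>
  A finite simple undirected graph is a \<open>pair_graph\<close>: a finite vertex set \<open>pverts G\<close> with a
  symmetric and irreflexive adjacency relation \<open>parcs G\<close> on it. A cycle is given by the list of
  its consecutive arcs; a closed walk of length two, running through an edge and back, counts
  as a cycle in Graph_Theory, but is too short to matter here.
\<close>

definition has_chord :: "'v pair_pre_digraph \<Rightarrow> ('v \<times> 'v) list \<Rightarrow> bool" where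
  "has_chord G p \<longleftrightarrow>
    (\<exists>u\<in>fst ` set p. \<exists>v\<in>fst ` set p. (u, v) \<in> parcs G \<and> (u, v) \<notin> set p \<and> (v, u) \<notin> set p)"

definition chordal :: "'v pair_pre_digraph \<Rightarrow> bool" where
  "chordal G \<longleftrightarrow> (\<forall>p. pre_digraph.cycle (with_proj G) p \<and> length p > 3 \<longrightarrow> has_chord G p)"

text \<open>Homomorphisms are \<open>undefined\<close> off the vertex set, so that equal maps are equal functions.\<close>

definition graph_homs :: "'a pair_pre_digraph \<Rightarrow> 'b pair_pre_digraph \<Rightarrow> ('a \<Rightarrow> 'b) set" where
  "graph_homs G H =
    {f \<in> pverts G \<rightarrow>\<^sub>E pverts H. \<forall>(u, v)\<in>parcs G. f u = f v \<or> (f u, f v) \<in> parcs H}"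

text \<open>In the vertices of the cube, \<open>True\<close> stands for 1 and \<open>False\<close> for 0.\<close>

definition cube_graph :: "nat \<Rightarrow> bool list pair_pre_digraph" where
  "cube_graph n =
    \<lparr>pverts = {a. length a = n},
     parcs = {(a, b). length a = n \<and> length b = n \<and> card {i. i < n \<and> a ! i \<noteq> b ! i} = 1}\<rparr>"


section \<open>Discrete cubical homology\<close>

definition singular_cubes :: "'v pair_pre_digraph \<Rightarrow> nat \<Rightarrow> (bool list \<Rightarrow> 'v) set" where
  "singular_cubes G n = graph_homs (cube_graph n) G"

text \<open>
  \<open>face n i e s\<close> is the face of the \<open>n\<close>-cube \<open>s\<close> obtained by inserting \<open>e\<close> as the \<open>i\<close>-th
  coordinate, where coordinates are counted from 1.
\<close>

definition face :: "nat \<Rightarrow> nat \<Rightarrow> bool \<Rightarrow> (bool list \<Rightarrow> 'v) \<Rightarrow> (bool list \<Rightarrow> 'v)" where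
  "face n i e s = restrict (\<lambda>a. s (take (i - 1) a @ [e] @ drop (i - 1) a)) {a. length a = n - 1}"

definition degenerate_cubes :: "'v pair_pre_digraph \<Rightarrow> nat \<Rightarrow> (bool list \<Rightarrow> 'v) set" where
  "degenerate_cubes G n = {s \<in> singular_cubes G n. \<exists>i\<in>{1..n}. face n i True s = face n i False s}"

definition cube_boundary ::
  "nat \<Rightarrow> ((bool list \<Rightarrow> 'v) \<Rightarrow>\<^sub>0 'r) \<Rightarrow> ((bool list \<Rightarrow> 'v) \<Rightarrow>\<^sub>0 'r::{comm_ring,comm_monoid_mult})" where
  "cube_boundary n = linear_extension (\<lambda>s.
     \<Sum>i = 1..n. scale ((- 1) ^ i)
       (Poly_Mapping.single (face n i False s) 1 - Poly_Mapping.single (face n i True s) 1))"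

text \<open>The elements of the chain modules are cosets of chains.\<close>

definition degenerate_cube_chains ::
  "'v pair_pre_digraph \<Rightarrow> nat \<Rightarrow> ((bool list \<Rightarrow> 'v) \<Rightarrow>\<^sub>0 'r::{comm_ring,comm_monoid_mult}) set" where
  "degenerate_cube_chains G n = carrier (free_module (degenerate_cubes G n))"

definition cube_chain_module ::
  "'v pair_pre_digraph \<Rightarrow> nat \<Rightarrow>
    ('r::{comm_ring,comm_monoid_mult}, ((bool list \<Rightarrow> 'v) \<Rightarrow>\<^sub>0 'r) set) module" where
  "cube_chain_module G n =
     quotient_module (free_module (singular_cubes G n)) (degenerate_cube_chains G n)"

definition cube_differential ::
  "'v pair_pre_digraph \<Rightarrow> nat \<Rightarrow> ((bool list \<Rightarrow> 'v) \<Rightarrow>\<^sub>0 'r) set \<Rightarrow>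
    ((bool list \<Rightarrow> 'v) \<Rightarrow>\<^sub>0 'r::{comm_ring,comm_monoid_mult}) set" where
  "cube_differential G n =
     induced_map (free_module (singular_cubes G (n - 1))) (degenerate_cube_chains G (n - 1))
       (cube_boundary n)"

definition cube_homology ::
  "'v pair_pre_digraph \<Rightarrow> nat \<Rightarrow>
    ('r::{comm_ring,comm_monoid_mult}, ((bool list \<Rightarrow> 'v) \<Rightarrow>\<^sub>0 'r) set set) module" where
  "cube_homology G = homology (cube_chain_module G) (cube_differential G)"


section \<open>Path homology\<close>

definition vertex_tuples :: "'v set \<Rightarrow> nat \<Rightarrow> 'v list set" where
  "vertex_tuples V n = {vs. set vs \<subseteq> V \<and> length vs = n + 1}"

definition nonregular_tuples :: "'v set \<Rightarrow> nat \<Rightarrow> 'v list set" where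
  "nonregular_tuples V n = {vs \<in> vertex_tuples V n. \<exists>i<n. vs ! i = vs ! Suc i}"

definition allowed_paths :: "'v pair_pre_digraph \<Rightarrow> nat \<Rightarrow> 'v list set" where
  "allowed_paths G n =
    {vs \<in> vertex_tuples (pverts G) n. \<forall>i<n. (vs ! i, vs ! Suc i) \<in> parcs G}"

definition path_boundary ::
  "nat \<Rightarrow> ('v list \<Rightarrow>\<^sub>0 'r) \<Rightarrow> ('v list \<Rightarrow>\<^sub>0 'r::{comm_ring,comm_monoid_mult})" where
  "path_boundary n = (if n = 0 then (\<lambda>_. 0) else linear_extension (\<lambda>vs.
     \<Sum>i = 0..n. scale ((- 1) ^ i) (Poly_Mapping.single (take i vs @ drop (Suc i) vs) 1)))"

definition nonregular_chains ::
  "'v set \<Rightarrow> nat \<Rightarrow> ('v list \<Rightarrow>\<^sub>0 'r::{comm_ring,comm_monoid_mult}) set" where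
  "nonregular_chains V n = carrier (free_module (nonregular_tuples V n))"

definition tuple_chain_module ::
  "'v set \<Rightarrow> nat \<Rightarrow> ('r::{comm_ring,comm_monoid_mult}, ('v list \<Rightarrow>\<^sub>0 'r) set) module" where
  "tuple_chain_module V n =
     quotient_module (free_module (vertex_tuples V n)) (nonregular_chains V n)"

definition path_differential ::
  "'v set \<Rightarrow> nat \<Rightarrow> ('v list \<Rightarrow>\<^sub>0 'r) set \<Rightarrow> ('v list \<Rightarrow>\<^sub>0 'r::{comm_ring,comm_monoid_mult}) set" where
  "path_differential V n =
     induced_map (free_module (vertex_tuples V (n - 1))) (nonregular_chains V (n - 1))
       (path_boundary n)"

text \<open>
  The submodule generated by the classes of the allowed paths is the image, under the projection
  to the quotient, of the free module on the allowed paths.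
\<close>

definition allowed_chains ::
  "'v pair_pre_digraph \<Rightarrow> nat \<Rightarrow> ('v list \<Rightarrow>\<^sub>0 'r::{comm_ring,comm_monoid_mult}) set set" where
  "allowed_chains G n =
     (\<lambda>c. nonregular_chains (pverts G) n +>\<^bsub>free_module (vertex_tuples (pverts G) n)\<^esub> c) `
       carrier (free_module (allowed_paths G n))"

text \<open>For \<open>n = 0\<close> the boundary is zero, hence no condition is imposed on it.\<close>

definition path_chain_module ::
  "'v pair_pre_digraph \<Rightarrow> nat \<Rightarrow> ('r::{comm_ring,comm_monoid_mult}, ('v list \<Rightarrow>\<^sub>0 'r) set) module" where
  "path_chain_module G n =
     (tuple_chain_module (pverts G) n)
       \<lparr>carrier := {X \<in> allowed_chains G n.
          n = 0 \<or> path_differential (pverts G) n X \<in> allowed_chains G (n - 1)}\<rparr>"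

definition path_homology ::
  "'v pair_pre_digraph \<Rightarrow> nat \<Rightarrow>
    ('r::{comm_ring,comm_monoid_mult}, ('v list \<Rightarrow>\<^sub>0 'r) set set) module" where
  "path_homology G = homology (path_chain_module G) (path_differential (pverts G))"

end

(*
  A chordal graph with an edge has a simplicial vertex z that is not isolated, and moving z to a
  neighbour is a homomorphism at distance at most one from the identity. Iterating, the identity is
  joined by such steps to an endomorphism that collapses every edge. Each step gives a prism
  operator between the maps induced on cubical chains, and likewise on path chains. The last
  endomorphism makes every chain of positive degree degenerate, so every cycle is a boundary
  modulo degenerate chains.
*)

theory Submission
  imports Defs
begin

section \<open>Linear maps and cosets of chains\<close>

text \<open>The boundary of an allowed path need not be allowed, and the prism over an allowed path
  may contain tuples with repeated entries, so the prism is not treated as an operator on the path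
  complex. All identities are proved in the free modules, where a cycle is a chain with degenerate
  or nonregular boundary. For paths the missing condition is recovered at the end: if a cycle
  \<open>c\<close> is \<open>\<Delta> a\<close> plus a nonregular chain, then
  \<open>\<Delta> a\<close> is allowed modulo nonregular chains because \<open>c\<close> is, so
  \<open>a\<close> belongs to the path complex. Moving a simplicial vertex \<open>z\<close> to a
  neighbour \<open>w\<close> is a homomorphism because the other neighbours of \<open>z\<close> are
  adjacent to \<open>w\<close>. Only the image of the endomorphism shrinks, never the graph. The
  last map is constant on components rather than constant; this is enough, since each cube and each
  path stays inside one component.\<close>

lemma lookup_scale [simp]: "Poly_Mapping.lookup (scale r c) x = r * Poly_Mapping.lookup c x"
  unfolding scale_def by (transfer) (auto simp: when_def)

lemma scale_add: "scale r (a + b) = scale r a + scale r b"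
  and scale_diff: "scale r (a - b) = scale r a - scale r b"
  and scale_left_add: "scale (r + s) a = scale r a + scale s a"
  and scale_scale: "scale r (scale s a) = scale (r * s) a"
  and scale_one [simp]: "scale 1 a = a"
  and scale_zero [simp]: "scale r 0 = 0"
  and scale_zero_left [simp]: "scale 0 a = 0"
  and scale_minus_left: "scale (- r) a = - scale r a"
  by (auto intro!: poly_mapping_eqI simp: lookup_add lookup_minus algebra_simps lookup_single when_def)

lemma scale_sign_Suc: "scale ((- 1) ^ Suc k) a = - scale ((- 1) ^ k) a"
  by (simp add: scale_minus_left)

lemma keys_scale: "Poly_Mapping.keys (scale r c) \<subseteq> Poly_Mapping.keys c"
  by (force simp: in_keys_iff)

lemma scale_sum: "scale r (sum F A) = (\<Sum>x\<in>A. scale r (F x))"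
  by (auto intro!: poly_mapping_eqI simp: lookup_sum sum_distrib_left)

abbreviation basis :: "'a \<Rightarrow> ('a \<Rightarrow>\<^sub>0 'r::{comm_ring,comm_monoid_mult})" where
  "basis x \<equiv> Poly_Mapping.single x 1"

definition linear_map ::
  "(('a \<Rightarrow>\<^sub>0 'r::{comm_ring,comm_monoid_mult}) \<Rightarrow> ('b \<Rightarrow>\<^sub>0 'r)) \<Rightarrow> bool" where
  "linear_map h \<longleftrightarrow> (\<forall>a b. h (a + b) = h a + h b) \<and> (\<forall>r a. h (scale r a) = scale r (h a))"

lemma linear_map_add: "linear_map h \<Longrightarrow> h (a + b) = h a + h b"
  and linear_map_scale: "linear_map h \<Longrightarrow> h (scale r a) = scale r (h a)"
  by (auto simp: linear_map_def)

lemma linear_map_zero: "linear_map h \<Longrightarrow> h 0 = 0"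
  by (metis linear_map_scale scale_zero_left)

lemma linear_map_diff: "linear_map h \<Longrightarrow> h (a - b) = h a - h b"
  by (metis add_diff_cancel diff_add_cancel linear_map_add)

lemma linear_map_sum: "linear_map h \<Longrightarrow> h (sum F A) = (\<Sum>x\<in>A. h (F x))"
  by (induction A rule: infinite_finite_induct) (auto simp: linear_map_zero linear_map_add)

lemma linear_map_id: "linear_map (\<lambda>c. c)"
  by (simp add: linear_map_def)

lemma linear_map_compose: "linear_map h \<Longrightarrow> linear_map k \<Longrightarrow> linear_map (\<lambda>c. h (k c))"
  by (simp add: linear_map_def)

lemma linear_map_plus: "linear_map h \<Longrightarrow> linear_map k \<Longrightarrow> linear_map (\<lambda>c. h c + k c)"
  and linear_map_minus: "linear_map h \<Longrightarrow> linear_map k \<Longrightarrow> linear_map (\<lambda>c. h c - k c)"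
  by (auto simp: linear_map_def scale_add scale_diff algebra_simps)

lemma linear_extension_superset:
  assumes "finite A" "Poly_Mapping.keys c \<subseteq> A"
  shows "linear_extension g c = (\<Sum>x\<in>A. scale (Poly_Mapping.lookup c x) (g x))"
  unfolding linear_extension_def using assms
  by (intro sum.mono_neutral_left) (auto simp: in_keys_iff)

lemma linear_extension_linear [simp]:
  fixes g :: "'a \<Rightarrow> ('b \<Rightarrow>\<^sub>0 'r::{comm_ring,comm_monoid_mult})"
  shows "linear_map (linear_extension g)"
  unfolding linear_map_def
proof (intro conjI allI)
  fix a b :: "'a \<Rightarrow>\<^sub>0 'r"
  let ?A = "Poly_Mapping.keys a \<union> Poly_Mapping.keys b"
  have "linear_extension g c = (\<Sum>x\<in>?A. scale (Poly_Mapping.lookup c x) (g x))"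
    if "c \<in> {a, b, a + b}" for c
    using that Poly_Mapping.keys_add[of a b] by (intro linear_extension_superset) auto
  then show "linear_extension g (a + b) = linear_extension g a + linear_extension g b"
    by (simp add: lookup_add scale_left_add sum.distrib)
next
  fix r and a :: "'a \<Rightarrow>\<^sub>0 'r"
  have "linear_extension g (scale r a)
      = (\<Sum>x\<in>Poly_Mapping.keys a. scale (Poly_Mapping.lookup (scale r a) x) (g x))"
    by (intro linear_extension_superset keys_scale) auto
  then show "linear_extension g (scale r a) = scale r (linear_extension g a)"
    by (simp add: linear_extension_def scale_sum scale_scale)
qed

lemma linear_extension_basis [simp]: "linear_extension g (basis x) = g x"
  by (subst linear_extension_superset[of "{x}"]) auto

lemma sum_basis: "c = (\<Sum>x\<in>Poly_Mapping.keys c. scale (Poly_Mapping.lookup c x) (basis x))"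
  by (rule poly_mapping_eqI)
    (auto simp: lookup_sum lookup_single when_def in_keys_iff if_distrib sum.delta cong: if_cong)

text \<open>Agreement is asked only on the support of \<open>c\<close>: \<open>path_boundary\<close>
  matches \<open>list_boundary\<close> only on tuples of the right length, and
  \<open>cube_map\<close> of \<open>id\<close> fixes only functions that are
  \<open>undefined\<close> off the cube.\<close>

lemma linear_map_eqI:
  assumes "linear_map h" "linear_map k" "\<And>x. x \<in> Poly_Mapping.keys c \<Longrightarrow> h (basis x) = k (basis x)"
  shows "h c = k c"
  by (subst (1 2) sum_basis)
    (simp add: assms linear_map_sum linear_map_scale)

section \<open>Submodules of chains and chains with prescribed support\<close>

definition submod :: "('a \<Rightarrow>\<^sub>0 'r::{comm_ring,comm_monoid_mult}) set \<Rightarrow> bool" where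
  "submod N \<longleftrightarrow> 0 \<in> N \<and> (\<forall>a\<in>N. \<forall>b\<in>N. a + b \<in> N) \<and> (\<forall>r. \<forall>a\<in>N. scale r a \<in> N)"

lemma submod_zero: "submod N \<Longrightarrow> 0 \<in> N"
  and submod_add: "submod N \<Longrightarrow> a \<in> N \<Longrightarrow> b \<in> N \<Longrightarrow> a + b \<in> N"
  and submod_scale: "submod N \<Longrightarrow> a \<in> N \<Longrightarrow> scale r a \<in> N"
  by (auto simp: submod_def)

lemma submod_uminus: "submod N \<Longrightarrow> a \<in> N \<Longrightarrow> - a \<in> N"
  using submod_scale[of N a "- 1"] by (simp add: scale_minus_left)

lemma submod_diff: "submod N \<Longrightarrow> a \<in> N \<Longrightarrow> b \<in> N \<Longrightarrow> a - b \<in> N"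
  using submod_add[of N a "- b"] submod_uminus[of N b] by simp

lemma submod_sum: "submod N \<Longrightarrow> (\<And>x. x \<in> A \<Longrightarrow> F x \<in> N) \<Longrightarrow> sum F A \<in> N"
  by (induction A rule: infinite_finite_induct) (auto simp: submod_zero submod_add)

lemma submod_image: "linear_map h \<Longrightarrow> submod N \<Longrightarrow> submod (h ` N)"
  unfolding submod_def
  by (auto simp: linear_map_zero image_iff simp flip: linear_map_add linear_map_scale)
    (metis linear_map_zero)+

lemma submod_Int: "submod M \<Longrightarrow> submod N \<Longrightarrow> submod (M \<inter> N)"
  by (auto simp: submod_def)

lemma sumsI: "x = a + b \<Longrightarrow> a \<in> M \<Longrightarrow> b \<in> N \<Longrightarrow> x \<in> {a + b | a b. a \<in> M \<and> b \<in> N}"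
  by (intro CollectI exI[of _ a] exI[of _ b]) simp

lemma submod_sums:
  assumes "submod M" "submod N"
  shows "submod {a + b | a b. a \<in> M \<and> b \<in> N}" (is "submod ?S")
proof -
  note S = sumsI[OF refl, of _ M _ N]
  show ?thesis
    unfolding submod_def
  proof (intro conjI ballI allI)
    have "(0::'a \<Rightarrow>\<^sub>0 'b) + 0 \<in> ?S" using assms by (intro S submod_zero)
    then show "0 \<in> ?S" by simp
  next
    fix x y assume "x \<in> ?S" "y \<in> ?S"
    then obtain a b c d where "x = a + b" "y = c + d" "a \<in> M" "b \<in> N" "c \<in> M" "d \<in> N"
      by blast
    moreover from this have "x + y = (a + c) + (b + d)" by (simp add: add_ac)
    ultimately show "x + y \<in> ?S" using assms by (simp only: S submod_add)
  next
    fix r x assume "x \<in> ?S"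
    then obtain a b where "x = a + b" "a \<in> M" "b \<in> N" by blast
    moreover from this have "scale r x = scale r a + scale r b" by (simp add: scale_add)
    ultimately show "scale r x \<in> ?S" using assms by (simp only: S submod_scale)
  qed
qed

abbreviation chains_on :: "'a set \<Rightarrow> ('a \<Rightarrow>\<^sub>0 'r::{comm_ring,comm_monoid_mult}) set" where
  "chains_on S \<equiv> {c. Poly_Mapping.keys c \<subseteq> S}"

lemma submod_chains_on: "submod (chains_on S)"
  unfolding submod_def
proof (intro conjI ballI allI)
  fix a b :: "'a \<Rightarrow>\<^sub>0 'b" assume "a \<in> chains_on S" "b \<in> chains_on S"
  then show "a + b \<in> chains_on S" using Poly_Mapping.keys_add[of a b] by auto
next
  fix r and a :: "'a \<Rightarrow>\<^sub>0 'b" assume "a \<in> chains_on S"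
  moreover have "Poly_Mapping.keys (scale r a) \<subseteq> Poly_Mapping.keys a" by (rule keys_scale)
  ultimately show "scale r a \<in> chains_on S" by auto
qed auto

lemma basis_in_chains_on: "x \<in> S \<Longrightarrow> basis x \<in> chains_on S"
  by auto

lemma linear_map_in_submod:
  assumes "linear_map h" "submod N" "c \<in> chains_on S" "\<And>x. x \<in> S \<Longrightarrow> h (basis x) \<in> N"
  shows "h c \<in> N"
  by (subst sum_basis)
    (use assms in \<open>auto simp: linear_map_sum linear_map_scale intro!: submod_sum submod_scale\<close>)

text \<open>Splits a prism chain into an allowed and a nonregular part. A basis element goes to one
  side, with 0 on the other, and linearity does the rest.\<close>

lemma chains_on_Un: "chains_on (A \<union> B) \<subseteq> {a + b | a b. a \<in> chains_on A \<and> b \<in> chains_on B}"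
proof
  fix c :: "'a \<Rightarrow>\<^sub>0 'b" assume "c \<in> chains_on (A \<union> B)"
  moreover have "basis x \<in> {a + b | a b. a \<in> chains_on A \<and> b \<in> chains_on B}" if "x \<in> A \<union> B" for x :: 'a
    using that
  proof
    assume "x \<in> A"
    then show ?thesis by (intro CollectI exI[of _ "basis x"] exI[of _ 0]) auto
  next
    assume "x \<in> B"
    then show ?thesis by (intro CollectI exI[of _ "basis x"] exI[of _ 0]) auto
  qed
  ultimately show "c \<in> {a + b | a b. a \<in> chains_on A \<and> b \<in> chains_on B}"
    by (rule linear_map_in_submod[OF linear_map_id submod_sums[OF submod_chains_on submod_chains_on]])
qed

abbreviation push :: "('a \<Rightarrow> 'b) \<Rightarrow> ('a \<Rightarrow>\<^sub>0 'r::{comm_ring,comm_monoid_mult}) \<Rightarrow> ('b \<Rightarrow>\<^sub>0 'r)" where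
  "push f \<equiv> linear_extension (\<lambda>x. basis (f x))"

lemma push_push: "push g (push f c) = push (\<lambda>x. g (f x)) c"
  by (rule linear_map_eqI[OF linear_map_compose[OF linear_extension_linear linear_extension_linear]
        linear_extension_linear]) simp

lemma push_in_chains_on:
  assumes "c \<in> chains_on S" "\<And>x. x \<in> S \<Longrightarrow> f x \<in> T"
  shows "push f c \<in> chains_on T"
  by (rule linear_map_in_submod[OF _ submod_chains_on assms(1)]) (use assms(2) in auto)

text \<open>Cosets in \<open>free_module S\<close> involve \<open>S\<close> only through the record,
  not through its carrier; this form drops the record.\<close>

definition coset :: "('a \<Rightarrow>\<^sub>0 'r::{comm_ring,comm_monoid_mult}) set \<Rightarrow> ('a \<Rightarrow>\<^sub>0 'r) \<Rightarrow> ('a \<Rightarrow>\<^sub>0 'r) set" where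
  "coset N x = (\<lambda>n. n + x) ` N"

lemma free_module_simps:
  "x \<oplus>\<^bsub>free_module S\<^esub> y = x + y" "r \<odot>\<^bsub>free_module S\<^esub> x = scale r x"
  "carrier (free_module S) = chains_on S"
  by (simp_all add: free_module_def)

lemma a_r_coset_free: "N +>\<^bsub>free_module S\<^esub> x = coset N x"
  by (auto simp: a_r_coset_def' coset_def free_module_simps)

lemma coset_eq_iff: "submod N \<Longrightarrow> coset N x = coset N y \<longleftrightarrow> x - y \<in> N"
proof
  assume N: "submod N" and eq: "coset N x = coset N y"
  have "x \<in> coset N x" using submod_zero[OF N] by (force simp: coset_def)
  then obtain n where "n \<in> N" "x = n + y" unfolding eq by (auto simp: coset_def)
  then show "x - y \<in> N" by simp
next
  have aux: "coset N x \<subseteq> coset N y" if N: "submod N" and xy: "x - y \<in> N" for x y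
  proof
    fix z assume "z \<in> coset N x"
    then obtain n where n: "n \<in> N" "z = n + x" by (auto simp: coset_def)
    then have "z = (n + (x - y)) + y" by simp
    with n xy N show "z \<in> coset N y" unfolding coset_def by (blast intro: submod_add)
  qed
  assume N: "submod N" and xy: "x - y \<in> N"
  have "y - x \<in> N" using submod_uminus[OF N xy] by simp
  then show "coset N x = coset N y" using aux[OF N] xy by blast
qed

lemma coset_zero: "coset N 0 = N"
  by (simp add: coset_def)

lemma coset_self_iff: "submod N \<Longrightarrow> coset N x = N \<longleftrightarrow> x \<in> N"
  using coset_eq_iff[of N x 0] by (simp add: coset_zero)

lemma set_add_coset:
  assumes "submod N"
  shows "set_add (free_module S) (coset N x) (coset N y) = coset N (x + y)"
proof -
  have "set_add (free_module S) (coset N x) (coset N y) = (\<Union>n\<in>N. \<Union>m\<in>N. {n + x + (m + y)})"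
    by (simp add: set_add_def' coset_def free_module_simps)
  also have "\<dots> = (\<Union>n\<in>N. \<Union>m\<in>N. {(n + m) + (x + y)})" by (simp add: add_ac)
  also have "\<dots> = coset N (x + y)"
  proof (intro equalityI subsetI)
    fix z assume "z \<in> coset N (x + y)"
    then obtain n where "n \<in> N" "z = (n + 0) + (x + y)" by (auto simp: coset_def)
    then show "z \<in> (\<Union>n\<in>N. \<Union>m\<in>N. {(n + m) + (x + y)})" using submod_zero[OF assms] by blast
  next
    fix z assume "z \<in> (\<Union>n\<in>N. \<Union>m\<in>N. {(n + m) + (x + y)})"
    then show "z \<in> coset N (x + y)" using assms by (auto simp: coset_def submod_add)
  qed
  finally show ?thesis .
qed

text \<open>\<open>induced_map\<close> is a union over all representatives. As \<open>h\<close> maps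
  \<open>N\<close> into \<open>N'\<close>, they all have the same image coset, and the union
  collapses to it.\<close>

lemma induced_map_coset:
  assumes h: "linear_map h" "h ` N \<subseteq> N'" and N: "submod N" "submod N'"
  shows "induced_map (free_module S) N' h (coset N x) = coset N' (h x)"
proof -
  have "coset N' (h y) = coset N' (h x)" if y: "y \<in> coset N x" for y
  proof -
    obtain n where n: "n \<in> N" "y = n + x" using y by (auto simp: coset_def)
    then have "h y - h x = h n" using h(1) by (simp add: linear_map_add)
    moreover have "h n \<in> N'" using n h(2) by blast
    ultimately show ?thesis using N by (simp add: coset_eq_iff)
  qed
  moreover have "x \<in> coset N x" using submod_zero[OF N(1)] by (force simp: coset_def)
  ultimately show ?thesis unfolding induced_map_def a_r_coset_free by blast
qed

text \<open>The scalar action on a quotient has the shape of \<open>induced_map\<close> for the map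
  \<open>scale r\<close>, which is linear because the ring is commutative.\<close>

lemma scale_coset:
  assumes "submod N"
  shows "(\<Union>y\<in>coset N x. N +>\<^bsub>free_module S\<^esub> (r \<odot>\<^bsub>free_module S\<^esub> y)) = coset N (scale r x)"
proof -
  have "linear_map (scale r :: ('a \<Rightarrow>\<^sub>0 'b) \<Rightarrow> _)"
    by (simp add: linear_map_def scale_add scale_scale mult.commute)
  moreover have "scale r ` N \<subseteq> N" using assms by (auto simp: submod_scale)
  ultimately show ?thesis
    using induced_map_coset[of "scale r" N N S x] assms by (simp add: induced_map_def free_module_simps)
qed

lemma a_rcosets_free: "a_rcosets\<^bsub>free_module S\<^esub> N = coset N ` chains_on S"
  by (auto simp: A_RCOSETS_def' a_r_coset_free free_module_simps)

lemma quotient_module_simps: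
  "carrier (quotient_module M N) = a_rcosets\<^bsub>M\<^esub> N"
  "\<zero>\<^bsub>quotient_module M N\<^esub> = N"
  "X \<oplus>\<^bsub>quotient_module M N\<^esub> Y = set_add M X Y"
  "r \<odot>\<^bsub>quotient_module M N\<^esub> X = (\<Union>x\<in>X. N +>\<^bsub>M\<^esub> (r \<odot>\<^bsub>M\<^esub> x))"
  by (simp_all add: quotient_module_def)

text \<open>\<open>B\<close> holds representatives of the boundaries. Every cycle is a boundary, so
  all cosets in the homology coincide; some cycle must exist for the one coset to occur. Only the
  operations of \<open>C n\<close> are prescribed, not its carrier, so that the lemma fits both the
  full cubical quotient and the smaller path complex.\<close>

lemma homology_trivial:
  fixes C :: "nat \<Rightarrow> ('r::{comm_ring,comm_monoid_mult}, ('a \<Rightarrow>\<^sub>0 'r) set) module"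
  assumes N: "submod N" and B: "submod B"
    and C: "\<And>X Y. X \<oplus>\<^bsub>C n\<^esub> Y = set_add (free_module S) X Y"
      "\<And>r X. r \<odot>\<^bsub>C n\<^esub> X = (\<Union>x\<in>X. N +>\<^bsub>free_module S\<^esub> (r \<odot>\<^bsub>free_module S\<^esub> x))"
    and bd: "boundaries C d n = coset N ` B"
    and cyc: "cycles C d n \<subseteq> coset N ` B" "cycles C d n \<noteq> {}"
  shows "carrier (homology C d n) = {coset N ` B}"
    and "coset N ` B \<oplus>\<^bsub>homology C d n\<^esub> coset N ` B = coset N ` B"
    and "r \<odot>\<^bsub>homology C d n\<^esub> (coset N ` B) = coset N ` B"
proof -
  have add: "coset N x \<oplus>\<^bsub>C n\<^esub> coset N y = coset N (x + y)" for x y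
    using N by (simp add: C set_add_coset)
  have scl: "r \<odot>\<^bsub>C n\<^esub> coset N x = coset N (scale r x)" for r x
    unfolding C using N by (rule scale_coset)
  let ?M = "(C n)\<lparr>carrier := cycles C d n\<rparr>"
  \<comment> \<open>Translation by a boundary permutes the boundaries.\<close>
  have shift: "(coset N ` B) +>\<^bsub>?M\<^esub> X = coset N ` B" if X: "X \<in> coset N ` B" for X
  proof -
    obtain x where x: "x \<in> B" "X = coset N x" using X by blast
    have "(coset N ` B) +>\<^bsub>?M\<^esub> X = (\<lambda>b. coset N (b + x)) ` B"
      by (auto simp: a_r_coset_def' x add)
    also have "\<dots> = coset N ` ((\<lambda>b. b + x) ` B)" by (simp add: image_image)
    also have "(\<lambda>b. b + x) ` B = B" using coset_self_iff[OF B, of x] x by (simp add: coset_def)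
    finally show ?thesis .
  qed
  show "carrier (homology C d n) = {coset N ` B}"
  proof -
    have "carrier (homology C d n) = (\<Union>X\<in>cycles C d n. {(coset N ` B) +>\<^bsub>?M\<^esub> X})"
      by (simp add: homology_def quotient_module_simps A_RCOSETS_def' bd)
    also have "\<dots> = (\<Union>X\<in>cycles C d n. {coset N ` B})"
      by (intro SUP_cong[OF refl] arg_cong[where f = "\<lambda>Y. {Y}"] shift subsetD[OF cyc(1)])
    also have "\<dots> = {coset N ` B}" using cyc(2) by auto
    finally show ?thesis .
  qed
  show "coset N ` B \<oplus>\<^bsub>homology C d n\<^esub> coset N ` B = coset N ` B"
  proof -
    have "set_add ?M (coset N ` B) (coset N ` B) = (\<Union>X\<in>coset N ` B. (coset N ` B) +>\<^bsub>?M\<^esub> X)"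
      unfolding set_add_def' a_r_coset_def' by (rule SUP_commute)
    also have "\<dots> = (\<Union>X\<in>coset N ` B. coset N ` B)"
      by (rule SUP_cong[OF refl]) (rule shift)
    also have "\<dots> = coset N ` B" using submod_zero[OF B] by auto
    finally show ?thesis by (simp add: homology_def quotient_module_simps bd)
  qed
  show "r \<odot>\<^bsub>homology C d n\<^esub> (coset N ` B) = coset N ` B"
  proof -
    have "r \<odot>\<^bsub>?M\<^esub> X \<in> coset N ` B" if "X \<in> coset N ` B" for X
      using that submod_scale[OF B] by (auto simp: scl)
    then have "(\<Union>X\<in>coset N ` B. (coset N ` B) +>\<^bsub>?M\<^esub> (r \<odot>\<^bsub>?M\<^esub> X)) = (\<Union>X\<in>coset N ` B. coset N ` B)"
      by (intro SUP_cong[OF refl] shift)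
    also have "\<dots> = coset N ` B" using submod_zero[OF B] by auto
    finally show ?thesis by (simp add: homology_def quotient_module_simps bd)
  qed
qed

text \<open>Telescoping along a chain of homotopy steps; \<open>F f\<close> will be the image of a
  fixed cycle under \<open>f\<close>.\<close>

lemma rtranclp_difference_in_submod:
  assumes "R\<^sup>*\<^sup>* f g" "submod B" "\<And>f g. R f g \<Longrightarrow> F f - F g \<in> B"
  shows "F f - F g \<in> B"
  using assms(1)
proof induction
  case (step g h)
  have "F f - F h = (F f - F g) + (F g - F h)" by simp
  with step assms show ?case by (metis submod_add)
qed (use assms in \<open>simp add: submod_zero\<close>)

section \<open>Contracting chordal graphs\<close>

text \<open>\<open>zip q (tl q @ [x])\<close> is the arc list of the walk through \<open>q\<close>
  that ends in \<open>x\<close>; with the arc \<open>(x, hd q)\<close> in front it becomes the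
  closed walk used in \<open>chordal_cone\<close>.\<close>

lemma zip_rotate_arcs:
  assumes "q \<noteq> []"
  shows "pcas (hd q) (zip q (tl q @ [x])) x \<and> pawalk_verts (hd q) (zip q (tl q @ [x])) = q @ [x]"
  using assms
proof (induction q rule: list_nonempty_induct)
  case (cons a as)
  then obtain b bs where "as = b # bs" by (cases as) auto
  with cons show ?case by auto
qed auto

lemma zip_rotate_subset:
  assumes "q \<noteq> []" "successively (\<lambda>u v. (u, v) \<in> E) q" "(last q, x) \<in> E"
  shows "set (zip q (tl q @ [x])) \<subseteq> E"
  using assms
proof (induction q rule: list_nonempty_induct)
  case (cons a as)
  then obtain b bs where "as = b # bs" by (cases as) auto
  with cons show ?case by auto
qed auto

lemma zip_rotate_nth:
  "Suc i < length q \<Longrightarrow> (q ! i, q ! Suc i) \<in> set (zip q (tl q @ [x]))"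
  "q \<noteq> [] \<Longrightarrow> (last q, x) \<in> set (zip q (tl q @ [x]))"
proof -
  assume "Suc i < length q"
  then show "(q ! i, q ! Suc i) \<in> set (zip q (tl q @ [x]))"
    by (force simp: set_zip nth_append nth_tl)
next
  assume "q \<noteq> []"
  then show "(last q, x) \<in> set (zip q (tl q @ [x]))"
    by (force simp: set_zip nth_append last_conv_nth)
qed

section \<open>Chords, shortest walks and simplicial vertices\<close>

locale chordal_graph = pair_graph +
  assumes chordal: "chordal G"
begin

abbreviation adj (infix "\<rightarrow>" 50) where "u \<rightarrow> v \<equiv> (u, v) \<in> parcs G"

lemma adj_sym: "u \<rightarrow> v \<Longrightarrow> v \<rightarrow> u"
  using pair_sym_arcs by (auto simp: symmetric_def sym_def)

lemma adj_irrefl: "\<not> u \<rightarrow> u"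
  using pair_no_loops[of "(u, u)"] by auto

text \<open>Closing \<open>q\<close> up through \<open>x\<close> gives a cycle of length at least
  four. Its chord cannot meet \<open>x\<close>, whose only neighbours on \<open>q\<close> are the
  two ends, already joined to \<open>x\<close> by arcs of the cycle; so it joins two nonconsecutive
  entries of \<open>q\<close>.\<close>

lemma chordal_cone:
  assumes dist: "distinct (x # q)" and len: "length q \<ge> 3"
    and walk: "successively (\<rightarrow>) q" and hd: "x \<rightarrow> hd q" and last: "last q \<rightarrow> x"
    and inner: "\<And>i. 0 < i \<Longrightarrow> Suc i < length q \<Longrightarrow> \<not> x \<rightarrow> q ! i"
  shows "\<exists>i j. Suc i < j \<and> j < length q \<and> q ! i \<rightarrow> q ! j"
proof -
  define p where "p = (x, hd q) # zip q (tl q @ [x])"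
  have ne: "q \<noteq> []" using len by auto
  have "set p \<subseteq> parcs G"
    using hd last walk ne by (auto simp: p_def dest!: zip_rotate_subset[THEN subsetD, rotated -1])
  moreover have "x \<in> pverts G" using hd by (rule in_arcsD1)
  ultimately have "cycle p"
    unfolding cycle_def awalk_def using zip_rotate_arcs[OF ne, of x] dist
    by (intro exI[of _ x]) (auto simp: p_def)
  moreover have "length p > 3" using len by (auto simp: p_def)
  ultimately have "has_chord G p" using chordal unfolding chordal_def by blast
  then obtain u v where uv: "u \<in> fst ` set p" "v \<in> fst ` set p" "u \<rightarrow> v" "(u, v) \<notin> set p" "(v, u) \<notin> set p"
    unfolding has_chord_def by blast
  have fsts: "fst ` set p = insert x (set q)"
    using ne by (simp add: p_def flip: set_map)
  have apex: "w \<notin> set q" if "x \<rightarrow> w" "(x, w) \<notin> set p" "(w, x) \<notin> set p" for w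
  proof
    assume "w \<in> set q"
    then obtain i where i: "i < length q" "w = q ! i" by (auto simp: in_set_conv_nth)
    have "i \<noteq> 0" using that(2) i ne by (auto simp: p_def hd_conv_nth intro!: Nat.gr0I)
    moreover have "Suc i \<noteq> length q"
    proof
      assume "Suc i = length q"
      then have "last q = w" using i ne by (metis diff_Suc_1 last_conv_nth)
      then show False using that(3) zip_rotate_nth(2)[OF ne, of x] by (simp add: p_def)
    qed
    ultimately show False using inner[of i] i that(1) by auto
  qed
  have "u \<noteq> v" using uv(3) adj_irrefl by auto
  moreover have "u \<noteq> x" using apex[of v] uv fsts \<open>u \<noteq> v\<close> by auto
  moreover have "v \<noteq> x" using apex[of u] uv fsts \<open>u \<noteq> v\<close> adj_sym by auto
  ultimately obtain i j where ij: "i < length q" "u = q ! i" "j < length q" "v = q ! j" "i \<noteq> j"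
    using uv fsts by (auto simp: in_set_conv_nth)
  have "Suc i \<noteq> j" "Suc j \<noteq> i"
    using zip_rotate_nth(1)[of i q x] zip_rotate_nth(1)[of j q x] ij uv by (auto simp: p_def)
  with ij(5) have "Suc i < j \<or> Suc j < i" by linarith
  then show ?thesis using ij uv(3) adj_sym by blast
qed

text \<open>A shortest walk from \<open>s\<close> to \<open>t\<close> with inner vertices in
  \<open>C\<close> has no shortcuts and no repetitions. Were \<open>s\<close> and \<open>t\<close>
  not adjacent, it would have at least three vertices and contradict \<open>chordal_cone\<close>
  with apex \<open>x\<close>.\<close>

lemma chordal_link_clique:
  assumes st: "x \<rightarrow> s" "x \<rightarrow> t" and ne: "s \<noteq> t" and C: "x \<notin> C" "\<And>c. c \<in> C \<Longrightarrow> \<not> x \<rightarrow> c"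
    and walk: "successively (\<rightarrow>) q" "q \<noteq> []" "hd q = s" "last q = t" "set q \<subseteq> C \<union> {s, t}"
  shows "s \<rightarrow> t"
proof (rule ccontr)
  assume nst: "\<not> s \<rightarrow> t"
  define P where "P = (\<lambda>q. successively (\<rightarrow>) q \<and> q \<noteq> [] \<and> hd q = s \<and> last q = t \<and> set q \<subseteq> C \<union> {s, t})"
  define m where "m = arg_min length P"
  have "P q" using walk by (simp add: P_def)
  then have m: "P m" and least: "\<And>q'. P q' \<Longrightarrow> length m \<le> length q'"
    unfolding m_def using arg_min_nat_lemma[of P q length] by auto
  \<comment> \<open>An arc from \<open>m ! i\<close> to \<open>m ! j\<close> would allow the entries
    strictly between to be cut out.\<close>
  have no_short: "\<not> m ! i \<rightarrow> m ! j" if ij: "Suc i < j" "j < length m" for i j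
  proof
    assume a: "m ! i \<rightarrow> m ! j"
    have "P (take (Suc i) m @ drop j m)"
    proof -
      have "successively (\<rightarrow>) (take (Suc i) m)" "successively (\<rightarrow>) (drop j m)"
        using m ij unfolding P_def by (auto simp: successively_conv_nth)
      moreover have "last (take (Suc i) m) = m ! i" using ij by (simp add: take_Suc_conv_app_nth)
      moreover have "hd (drop j m) = m ! j" using ij by (simp add: hd_drop_conv_nth)
      ultimately show ?thesis using m ij a unfolding P_def
        by (auto simp: successively_append_iff hd_append dest: in_set_takeD in_set_dropD)
    qed
    then show False using least ij by fastforce
  qed
  \<comment> \<open>If \<open>i = 0\<close>, the walk could start at \<open>j\<close> instead.
    Otherwise the predecessor of \<open>m ! i\<close> is also adjacent to \<open>m ! j\<close>,
    which is a shortcut.\<close>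
  have dist: "m ! i \<noteq> m ! j" if ij: "i < j" "j < length m" for i j
  proof
    assume eq: "m ! i = m ! j"
    show False
    proof (cases i)
      case 0
      have "P (drop j m)"
        using m ij eq 0 unfolding P_def
        by (auto simp: successively_conv_nth hd_drop_conv_nth hd_conv_nth dest: in_set_dropD)
      then show False using least[of "drop j m"] ij by auto
    next
      case (Suc k)
      have "m ! k \<rightarrow> m ! Suc k" using m Suc ij unfolding P_def by (auto simp: successively_conv_nth)
      then show False using no_short[of k j] Suc ij eq by auto
    qed
  qed
  then have d: "distinct m" by (auto simp: distinct_conv_nth) (metis nat_neq_iff)
  have xm: "x \<notin> set m" using m C st adj_irrefl unfolding P_def by auto
  \<comment> \<open>One vertex would mean \<open>s = t\<close>, two would make them
    adjacent.\<close>
  have len: "length m \<ge> 3"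
  proof -
    have "m \<noteq> []" "hd m = s" "last m = t" "successively (\<rightarrow>) m" using m unfolding P_def by auto
    then show ?thesis using ne nst by (cases m rule: remdups_adj.cases) (auto split: if_splits simp: Suc_le_eq)
  qed
  have "\<not> x \<rightarrow> m ! i" if i: "0 < i" "Suc i < length m" for i
  proof -
    have "m ! i \<noteq> m ! 0" "m ! i \<noteq> m ! (length m - 1)"
      using dist[of 0 i] dist[of i "length m - 1"] i by auto
    then have "m ! i \<noteq> s" "m ! i \<noteq> t" using m unfolding P_def by (auto simp: hd_conv_nth last_conv_nth)
    moreover have "m ! i \<in> set m" using i by auto
    ultimately show ?thesis using m C unfolding P_def by auto
  qed
  then show False
    using chordal_cone[of x m] d xm len m st adj_sym no_short unfolding P_def by auto
qed

text \<open>The vertex set \<open>A\<close> stands for the subgraph that it spans. No induced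
  subgraph is formed, so chordality is always that of the whole graph.\<close>

definition simplicial :: "'a set \<Rightarrow> 'a \<Rightarrow> bool" where
  "simplicial A z \<longleftrightarrow> z \<in> A \<and> (\<forall>u\<in>A. \<forall>v\<in>A. z \<rightarrow> u \<and> z \<rightarrow> v \<longrightarrow> u = v \<or> u \<rightarrow> v)"

text \<open>
  Dirac's argument: the vertices outside a component \<open>C\<close> of the non-neighbours of \<open>x\<close> that are
  adjacent to \<open>C\<close> form a clique, and a vertex of \<open>C\<close> is simplicial as soon as it is
  simplicial in the smaller graph spanned by \<open>C\<close> and this clique.
\<close>

lemma simplicial_nonneighbour:
  assumes "finite A" "x \<in> A" "y \<in> A" "y \<noteq> x" "\<not> x \<rightarrow> y"
  shows "\<exists>z. z \<noteq> x \<and> \<not> x \<rightarrow> z \<and> simplicial A z"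
  using assms
proof (induction "card A" arbitrary: A x y rule: less_induct)
  case less
  define W where "W = {w \<in> A. w \<noteq> x \<and> \<not> x \<rightarrow> w}"
  define R where "R = parcs G \<inter> W \<times> W"
  define C where "C = {w. (y, w) \<in> R\<^sup>*}"
  define S where "S = {s \<in> A. s \<notin> C \<and> (\<exists>c\<in>C. s \<rightarrow> c)}"
  have yC: "y \<in> C" by (simp add: C_def)
  have yW: "y \<in> W" using less.prems by (simp add: W_def)
  have CW: "C \<subseteq> W"
  proof
    fix w assume "w \<in> C"
    then have "(y, w) \<in> R\<^sup>*" by (simp add: C_def)
    then show "w \<in> W" by (induction) (use yW in \<open>auto simp: R_def\<close>)
  qed
  have closed: "w \<in> C" if "c \<in> C" "c \<rightarrow> w" "w \<in> W" for c w
  proof -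
    have "(c, w) \<in> R" using that CW by (auto simp: R_def)
    then show ?thesis using that(1) by (auto simp: C_def)
  qed
  \<comment> \<open>A vertex of \<open>S\<close> that is neither \<open>x\<close> nor a neighbour of
    \<open>x\<close> lies in \<open>W\<close>, and being adjacent to \<open>C\<close> it would
    belong to \<open>C\<close>.\<close>
  have Sx: "x \<rightarrow> s" if "s \<in> S" for s
  proof -
    obtain c where c: "c \<in> C" "s \<rightarrow> c" "s \<in> A" "s \<notin> C" using \<open>s \<in> S\<close> by (auto simp: S_def)
    then have "s \<noteq> x" using CW by (auto simp: W_def)
    moreover have "s \<notin> W" using c closed adj_sym by blast
    ultimately show ?thesis using c by (auto simp: W_def)
  qed
  have clique: "s \<rightarrow> t" if s: "s \<in> S" and t: "t \<in> S" and ne: "s \<noteq> t" for s t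
  proof -
    obtain c d where cd: "c \<in> C" "s \<rightarrow> c" "d \<in> C" "t \<rightarrow> d" using s t by (auto simp: S_def)
    have "sym R" using adj_sym by (auto simp: R_def sym_def)
    then have "(c, y) \<in> R\<^sup>*" using cd(1) by (metis C_def mem_Collect_eq sym_rtrancl symD)
    with cd(3) have "(c, d) \<in> R\<^sup>*" by (auto simp: C_def)
    \<comment> \<open>The walk takes the arc from \<open>s\<close> into \<open>C\<close> and then
      follows a path from \<open>c\<close> to \<open>d\<close> inside \<open>C\<close>; appending
      \<open>t\<close> gives the walk for \<open>chordal_link_clique\<close>.\<close>
    then have "\<exists>q. successively (\<rightarrow>) q \<and> q \<noteq> [] \<and> hd q = s \<and> last q = d \<and> set q \<subseteq> C \<union> {s}"
    proof (induction)
      case base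
      then show ?case using cd by (intro exI[of _ "[s, c]"]) auto
    next
      case (step b e)
      then obtain q where q: "successively (\<rightarrow>) q" "q \<noteq> []" "hd q = s" "last q = b" "set q \<subseteq> C \<union> {s}"
        by blast
      have "(y, e) \<in> R\<^sup>*" using step(1,2) cd(1) by (auto simp: C_def)
      then have "e \<in> C" by (simp add: C_def)
      with q step(2) show ?case
        by (intro exI[of _ "q @ [e]"]) (auto simp: successively_append_iff R_def)
    qed
    then obtain q where q: "successively (\<rightarrow>) q" "q \<noteq> []" "hd q = s" "last q = d" "set q \<subseteq> C \<union> {s}"
      by blast
    show ?thesis
      by (rule chordal_link_clique[of x _ _ C "q @ [t]"])
        (use q cd s t ne Sx CW adj_sym in \<open>auto simp: successively_append_iff W_def\<close>)
  qed
  define H where "H = C \<union> S"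
  have HA: "H \<subseteq> A" using CW by (auto simp: H_def S_def W_def)
  have "x \<notin> H" using CW Sx adj_irrefl by (auto simp: H_def W_def)
  then have card: "card H < card A" using HA less.prems by (intro psubset_card_mono) auto
  have finH: "finite H" using HA less.prems(1) finite_subset by blast
  \<comment> \<open>All neighbours in \<open>A\<close> of a vertex of \<open>C\<close> lie in
    \<open>H\<close>, so passing from \<open>H\<close> to \<open>A\<close> adds no
    condition.\<close>
  have lift: "simplicial A z" if "z \<in> C" "simplicial H z" for z
  proof -
    have "u \<in> H" if "u \<in> A" "z \<rightarrow> u" for u
      using that \<open>z \<in> C\<close> adj_sym by (auto simp: H_def S_def)
    then show ?thesis using that(2) HA unfolding simplicial_def by blast
  qed
  have "\<exists>z\<in>C. simplicial H z"
  proof (cases "\<exists>u\<in>H. \<exists>w\<in>H. w \<noteq> u \<and> \<not> u \<rightarrow> w")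
    case True
    then obtain u w where uw: "u \<in> H" "w \<in> H" "w \<noteq> u" "\<not> u \<rightarrow> w" by blast
    from less.hyps[OF card finH uw]
    obtain z where z: "z \<noteq> u" "\<not> u \<rightarrow> z" "simplicial H z" by blast
    show ?thesis
    proof (cases "z \<in> C")
      case False
      then have zS: "z \<in> S" using z by (auto simp: simplicial_def H_def)
      \<comment> \<open>Second use of the induction hypothesis, now around \<open>z\<close>, with
        \<open>u\<close> as its non-neighbour: the new vertex is not adjacent to \<open>z\<close>,
        hence not in the clique \<open>S\<close>. This is why the claim provides a non-neighbour of
        \<open>x\<close> and not just any simplicial vertex.\<close>
      have "\<exists>z'. z' \<noteq> z \<and> \<not> z \<rightarrow> z' \<and> simplicial H z'"
        by (rule less.hyps[OF card finH, of z u]) (use z uw adj_sym in \<open>auto simp: simplicial_def\<close>)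
      then obtain z' where z': "z' \<noteq> z" "\<not> z \<rightarrow> z'" "simplicial H z'" by blast
      then have "z' \<notin> S" using clique zS by blast
      then have "z' \<in> C" using z' by (auto simp: simplicial_def H_def)
      then show ?thesis using z' by blast
    qed (use z in blast)
  next
    case False
    then have "u = w \<or> u \<rightarrow> w" if "u \<in> H" "w \<in> H" for u w using that by metis
    then have "simplicial H y" using yC by (simp add: simplicial_def H_def)
    then show ?thesis using yC by blast
  qed
  then show ?case using lift CW by (auto simp: W_def)
qed

lemma simplicial_exists:
  assumes "finite A" "A \<noteq> {}"
  shows "\<exists>z. simplicial A z"
proof (cases "\<exists>x\<in>A. \<exists>y\<in>A. y \<noteq> x \<and> \<not> x \<rightarrow> y")
  case True
  then show ?thesis using simplicial_nonneighbour[OF assms(1)] by blast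
next
  case False
  then have "x = y \<or> x \<rightarrow> y" if "x \<in> A" "y \<in> A" for x y using that by metis
  moreover obtain z where "z \<in> A" using assms(2) by blast
  ultimately show ?thesis by (intro exI[of _ z]) (simp add: simplicial_def)
qed

end

text \<open>
  Unlike the elements of \<^const>\<open>graph_homs\<close>, endomorphisms are not required to be \<open>undefined\<close>
  off the vertex set.
\<close>

definition graph_endo :: "'v pair_pre_digraph \<Rightarrow> ('v \<Rightarrow> 'v) \<Rightarrow> bool" where
  "graph_endo G f \<longleftrightarrow> (\<forall>x\<in>pverts G. f x \<in> pverts G) \<and>
     (\<forall>(u, v)\<in>parcs G. f u = f v \<or> (f u, f v) \<in> parcs G)"

text \<open>A discrete homotopy of length one: \<open>f\<close> and \<open>g\<close> are the two
  ends of a homomorphism from the Cartesian product of the graph with an edge.\<close>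

definition homotopic_step :: "'v pair_pre_digraph \<Rightarrow> ('v \<Rightarrow> 'v) \<Rightarrow> ('v \<Rightarrow> 'v) \<Rightarrow> bool" where
  "homotopic_step G f g \<longleftrightarrow> graph_endo G f \<and> graph_endo G g \<and>
     (\<forall>x\<in>pverts G. f x = g x \<or> (f x, g x) \<in> parcs G)"

section \<open>Collapsing the edges of a chordal graph by homotopies\<close>

context chordal_graph
begin

text \<open>Each round shrinks a set \<open>U\<close> containing the image. If \<open>z\<close> is
  simplicial among the non-isolated vertices of \<open>U\<close> and \<open>w\<close> is a neighbour
  of \<open>z\<close> there, then every neighbour of \<open>z\<close> in \<open>U\<close> is equal
  or adjacent to \<open>w\<close>. So sending \<open>z\<close> to \<open>w\<close> after
  \<open>f\<close> preserves adjacency and frees the image of \<open>z\<close>.\<close>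

lemma contract_image:
  assumes "finite U" "U \<subseteq> pverts G" "graph_endo G f" "f ` pverts G \<subseteq> U"
  shows "\<exists>g. (homotopic_step G)\<^sup>*\<^sup>* f g \<and> (\<forall>(u, v)\<in>parcs G. g u = g v)"
  using assms
proof (induction "card U" arbitrary: U f rule: less_induct)
  case less
  \<comment> \<open>An isolated vertex of \<open>U\<close> is simplicial too, but has no neighbour
    in \<open>U\<close> to be moved to.\<close>
  define A where "A = {u \<in> U. \<exists>v\<in>U. u \<rightarrow> v}"
  show ?case
  proof (cases "A = {}")
    case True
    have "f u = f v" if "u \<rightarrow> v" for u v
    proof -
      have "f u \<in> U" "f v \<in> U" using that less.prems(4) in_arcsD1 in_arcsD2 by blast+
      then have "\<not> f u \<rightarrow> f v" using True by (auto simp: A_def)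
      then show ?thesis using less.prems(3) that by (auto simp: graph_endo_def)
    qed
    then show ?thesis by (intro exI[of _ f]) auto
  next
    case False
    have "finite A" using less.prems(1) by (simp add: A_def)
    with False obtain z where z: "simplicial A z" using simplicial_exists by blast
    then obtain w where w: "z \<in> U" "w \<in> U" "z \<rightarrow> w" by (auto simp: simplicial_def A_def)
    then have wA: "w \<in> A" using adj_sym by (auto simp: A_def)
    have dom: "u = w \<or> w \<rightarrow> u" if "u \<in> U" "z \<rightarrow> u" for u
    proof -
      have "u \<in> A" using that w(1) adj_sym by (auto simp: A_def)
      then show ?thesis using z that w wA unfolding simplicial_def by blast
    qed
    define r where "r = (\<lambda>x. if f x = z then w else f x)"
    have rU: "r ` pverts G \<subseteq> U - {z}"
      using less.prems(4) w adj_irrefl by (auto simp: r_def)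
    have r: "graph_endo G r"
      unfolding graph_endo_def
    proof (intro conjI ballI, goal_cases)
      case (1 x)
      then show ?case using rU less.prems(2) by blast
    next
      case (2 e)
      obtain a b where e: "e = (a, b)" by (cases e)
      with 2 have arc: "a \<rightarrow> b" by simp
      have "f a \<in> U" "f b \<in> U"
        using less.prems(4) in_arcsD1[OF arc] in_arcsD2[OF arc] by blast+
      moreover have "f a = f b \<or> f a \<rightarrow> f b" using less.prems(3) arc by (auto simp: graph_endo_def)
      ultimately have "r a = r b \<or> r a \<rightarrow> r b"
        using dom[of "f a"] dom[of "f b"] adj_sym[of z "f a"] adj_sym[of "f a" z] adj_sym[of w "f a"]
        unfolding r_def by (cases "f a = z"; cases "f b = z"; simp; blast)
      then show ?case by (simp add: e)
    qed
    have step: "homotopic_step G f r"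
      using r less.prems(3) w(3) by (auto simp: homotopic_step_def r_def)
    have "card (U - {z}) < card U" using w(1) less.prems(1) by (meson card_Diff1_less)
    from less.hyps[OF this _ _ r rU] less.prems(1,2)
    obtain g where "(homotopic_step G)\<^sup>*\<^sup>* r g" "\<forall>(u, v)\<in>parcs G. g u = g v" by auto
    with step show ?thesis by (meson converse_rtranclp_into_rtranclp)
  qed
qed

text \<open>Homotopy steps never move a vertex out of its component, so for a disconnected graph no
  constant map is within reach; being constant along arcs takes its place.\<close>

lemma contractible_components:
  "\<exists>g. (homotopic_step G)\<^sup>*\<^sup>* id g \<and> (\<forall>(u, v)\<in>parcs G. g u = g v)"
  by (rule contract_image[of "pverts G"]) (auto simp: pair_finite_verts graph_endo_def)

end

section \<open>Cubical homology\<close>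

lemma parcs_cube_graph:
  "(a, b) \<in> parcs (cube_graph n) \<longleftrightarrow> length a = n \<and> (\<exists>i<n. b = a[i := \<not> a ! i])"
proof
  assume "(a, b) \<in> parcs (cube_graph n)"
  then have len: "length a = n" "length b = n" and "card {i. i < n \<and> a ! i \<noteq> b ! i} = 1"
    by (auto simp: cube_graph_def)
  then obtain i where i: "{i. i < n \<and> a ! i \<noteq> b ! i} = {i}" by (elim card_1_singletonE)
  have "j < n \<Longrightarrow> (a ! j \<noteq> b ! j) = (j = i)" for j using i by auto
  moreover have "i < n" using i by auto
  ultimately have "b = a[i := \<not> a ! i]"
    using len by (intro nth_equalityI) (auto simp: nth_list_update)
  with len \<open>i < n\<close> show "length a = n \<and> (\<exists>i<n. b = a[i := \<not> a ! i])" by auto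
next
  assume "length a = n \<and> (\<exists>i<n. b = a[i := \<not> a ! i])"
  then obtain i where i: "length a = n" "i < n" "b = a[i := \<not> a ! i]" by auto
  then have "{j. j < n \<and> a ! j \<noteq> b ! j} = {i}" by (auto simp: nth_list_update)
  with i show "(a, b) \<in> parcs (cube_graph n)" by (simp add: cube_graph_def)
qed

lemma singular_cubes_iff:
  "s \<in> singular_cubes G n \<longleftrightarrow> s \<in> {a. length a = n} \<rightarrow>\<^sub>E pverts G \<and>
     (\<forall>a i. length a = n \<longrightarrow> i < n \<longrightarrow>
        s a = s (a[i := \<not> a ! i]) \<or> (s a, s (a[i := \<not> a ! i])) \<in> parcs G)"
proof -
  have V: "pverts (cube_graph n) = {a. length a = n}" by (simp add: cube_graph_def)
  have "(\<forall>(a, b)\<in>parcs (cube_graph n). s a = s b \<or> (s a, s b) \<in> parcs G) \<longleftrightarrow>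
      (\<forall>a b. length a = n \<and> (\<exists>i<n. b = a[i := \<not> a ! i]) \<longrightarrow> s a = s b \<or> (s a, s b) \<in> parcs G)"
    unfolding parcs_cube_graph[symmetric] by blast
  also have "\<dots> \<longleftrightarrow> (\<forall>a i. length a = n \<longrightarrow> i < n \<longrightarrow>
        s a = s (a[i := \<not> a ! i]) \<or> (s a, s (a[i := \<not> a ! i])) \<in> parcs G)"
    by metis
  finally show ?thesis
    unfolding singular_cubes_def graph_homs_def V mem_Collect_eq by (rule arg_cong)
qed

text \<open>Positions count from 0, whereas \<open>face\<close> counts from 1: the face at
  \<open>Suc i\<close> is composition with \<open>insert_at i e\<close>.\<close>

definition insert_at :: "nat \<Rightarrow> 'a \<Rightarrow> 'a list \<Rightarrow> 'a list" where
  "insert_at i e a = take i a @ e # drop i a"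

lemma length_insert_at [simp]: "length (insert_at i e a) = Suc (length a)"
  by (simp add: insert_at_def)

text \<open>The position shift behind two facts: faces of cubes are cubes, and a degenerate
  direction survives in the faces taken in other directions.\<close>

lemma insert_at_update:
  assumes "i \<le> length a" "j < length a"
  shows "insert_at i e (a[j := b]) = (insert_at i e a)[(if j < i then j else Suc j) := b]"
    and "insert_at i e a ! (if j < i then j else Suc j) = a ! j"
proof -
  show "insert_at i e a ! (if j < i then j else Suc j) = a ! j"
    using assms by (auto simp: insert_at_def nth_append)
  show "insert_at i e (a[j := b]) = (insert_at i e a)[(if j < i then j else Suc j) := b]"
    using assms
    by (intro nth_equalityI) (auto simp: insert_at_def nth_append nth_list_update nth_Cons split: nat.split)
qed

lemma insert_at_update_same: "i \<le> length a \<Longrightarrow> (insert_at i e a)[i := b] = insert_at i b a"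
  by (auto simp: insert_at_def list_update_append)

lemma update_eq_insert_at: "i < length a \<Longrightarrow> a[i := e] = insert_at i e (take i a @ drop (Suc i) a)"
  by (simp add: insert_at_def upd_conv_take_nth_drop)

lemma face_eq: "face (Suc m) (Suc i) e s = restrict (\<lambda>a. s (insert_at i e a)) {a. length a = m}"
  by (simp add: face_def insert_at_def)

lemma face_in_singular_cubes:
  assumes "s \<in> singular_cubes G (Suc m)" "i \<le> m"
  shows "face (Suc m) (Suc i) e s \<in> singular_cubes G m"
  unfolding singular_cubes_iff
proof (intro conjI allI impI)
  show "face (Suc m) (Suc i) e s \<in> {a. length a = m} \<rightarrow>\<^sub>E pverts G"
    using assms by (auto simp: face_eq singular_cubes_iff)
  fix a :: "bool list" and j assume a: "length a = m" "j < m"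
  define k where "k = (if j < i then j else Suc j)"
  have "insert_at i e (a[j := \<not> a ! j]) = (insert_at i e a)[k := \<not> insert_at i e a ! k]"
    unfolding k_def using insert_at_update[of i a j] assms a by auto
  moreover have "k < Suc m" using a by (simp add: k_def)
  ultimately show "face (Suc m) (Suc i) e s a = face (Suc m) (Suc i) e s (a[j := \<not> a ! j]) \<or>
      (face (Suc m) (Suc i) e s a, face (Suc m) (Suc i) e s (a[j := \<not> a ! j])) \<in> parcs G"
    using assms a by (auto simp: face_eq singular_cubes_iff)
qed

text \<open>The prism and collapse arguments evaluate cubes on lists of full length; testing
  degeneracy there avoids the change of dimension in \<open>face\<close>.\<close>

lemma degenerate_cubes_iff:
  "s \<in> degenerate_cubes G n \<longleftrightarrow> s \<in> singular_cubes G n \<and>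
     (\<exists>i<n. \<forall>a. length a = n \<longrightarrow> s (a[i := True]) = s (a[i := False]))"
proof (cases n)
  case (Suc m)
  have "face n (Suc i) True s = face n (Suc i) False s \<longleftrightarrow>
      (\<forall>a. length a = n \<longrightarrow> s (a[i := True]) = s (a[i := False]))" if i: "i < n" for i
  proof
    assume eq: "face n (Suc i) True s = face n (Suc i) False s"
    show "\<forall>a. length a = n \<longrightarrow> s (a[i := True]) = s (a[i := False])"
    proof (intro allI impI)
      fix a :: "bool list" assume "length a = n"
      then show "s (a[i := True]) = s (a[i := False])"
        using fun_cong[OF eq, of "take i a @ drop (Suc i) a"] i Suc
        by (simp add: face_eq update_eq_insert_at)
    qed
  next
    assume eq: "\<forall>a. length a = n \<longrightarrow> s (a[i := True]) = s (a[i := False])"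
    have "s (insert_at i True b) = s (insert_at i False b)" if "length b = m" for b
      using eq[rule_format, of "insert_at i True b"] that i Suc by (simp add: insert_at_update_same)
    then show "face n (Suc i) True s = face n (Suc i) False s"
      by (auto simp: face_eq Suc)
  qed
  moreover have "(\<exists>i\<in>{1..n}. P i) \<longleftrightarrow> (\<exists>i<n. P (Suc i))" for P
  proof -
    have "{1..n} = Suc ` {..<n}" by (simp add: image_Suc_lessThan)
    then show ?thesis by auto
  qed
  ultimately show ?thesis by (auto simp: degenerate_cubes_def)
qed (simp add: degenerate_cubes_def)

lemma degenerate_cube_chains_eq: "degenerate_cube_chains G n = chains_on (degenerate_cubes G n)"
  by (simp add: degenerate_cube_chains_def free_module_simps)

lemma linear_map_cube_boundary [simp]: "linear_map (cube_boundary n)"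
  by (simp add: cube_boundary_def)

lemma cube_boundary_basis:
  "cube_boundary n (basis s) = (\<Sum>i = 1..n. scale ((- 1) ^ i) (basis (face n i False s) - basis (face n i True s)))"
  by (simp add: cube_boundary_def)

text \<open>In a degenerate direction the two faces cancel within one summand; in any other
  direction both faces are still degenerate.\<close>

lemma cube_boundary_degenerate:
  assumes "c \<in> degenerate_cube_chains G (Suc m)"
  shows "cube_boundary (Suc m) c \<in> degenerate_cube_chains G m"
  unfolding degenerate_cube_chains_eq
proof (rule linear_map_in_submod[OF linear_map_cube_boundary submod_chains_on])
  show "c \<in> chains_on (degenerate_cubes G (Suc m))" using assms by (simp add: degenerate_cube_chains_eq)
  fix s assume s: "s \<in> degenerate_cubes G (Suc m)"
  then obtain j where j: "j < Suc m"
      and dg: "\<And>a. length a = Suc m \<Longrightarrow> s (a[j := True]) = s (a[j := False])"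
    and sing: "s \<in> singular_cubes G (Suc m)"
    by (auto simp: degenerate_cubes_iff)
  show "cube_boundary (Suc m) (basis s) \<in> chains_on (degenerate_cubes G m)"
    unfolding cube_boundary_basis
  proof (rule submod_sum[OF submod_chains_on], rule submod_scale[OF submod_chains_on])
    fix k assume "k \<in> {1..Suc m}"
    then obtain i where i: "k = Suc i" "i \<le> m" by (cases k) auto
    show "basis (face (Suc m) k False s) - basis (face (Suc m) k True s) \<in> chains_on (degenerate_cubes G m)"
    proof (cases "i = j")
      case True
      have "s (insert_at i True b) = s (insert_at i False b)" if "length b = m" for b
        using dg[of "insert_at i True b"] that i True by (simp add: insert_at_update_same)
      then have "face (Suc m) k False s = face (Suc m) k True s" by (auto simp: face_eq i)
      then show ?thesis by simp
    next
      case False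
      \<comment> \<open>The position of direction \<open>j\<close> among the coordinates that remain
        when coordinate \<open>i\<close> is removed.\<close>
      define l where "l = (if j < i then j else j - 1)"
      have l: "(if l < i then l else Suc l) = j" "l < m" using False j i by (auto simp: l_def)
      have "face (Suc m) k e s \<in> degenerate_cubes G m" for e
        unfolding degenerate_cubes_iff
      proof (intro conjI exI[of _ l] allI impI l)
        show "face (Suc m) k e s \<in> singular_cubes G m"
          using face_in_singular_cubes[OF sing i(2)] i by simp
        fix a :: "bool list" assume a: "length a = m"
        have "insert_at i e (a[l := b]) = (insert_at i e a)[j := b]" for b
          using insert_at_update(1)[of i a l e b] i a l by simp
        then show "face (Suc m) k e s (a[l := True]) = face (Suc m) k e s (a[l := False])"
          using a dg[of "insert_at i e a"] by (simp add: face_eq i)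
      qed
      then show ?thesis by (intro submod_diff[OF submod_chains_on] basis_in_chains_on)
    qed
  qed
qed

text \<open>The restriction keeps the values off the cube \<open>undefined\<close>, as membership in
  \<open>singular_cubes\<close> demands.\<close>

definition cube_map :: "nat \<Rightarrow> ('v \<Rightarrow> 'w) \<Rightarrow> (bool list \<Rightarrow> 'v) \<Rightarrow> (bool list \<Rightarrow> 'w)" where
  "cube_map n f s = restrict (f \<circ> s) {a. length a = n}"

text \<open>With the new coordinate in front, the faces of index 1 are the two ends and every old
  direction moves up by one, which reverses its sign in the boundary.\<close>

definition cube_prism :: "nat \<Rightarrow> ('v \<Rightarrow> 'w) \<Rightarrow> ('v \<Rightarrow> 'w) \<Rightarrow> (bool list \<Rightarrow> 'v) \<Rightarrow> (bool list \<Rightarrow> 'w)" where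
  "cube_prism n f g s = restrict (\<lambda>a. (if hd a then g else f) (s (tl a))) {a. length a = Suc n}"

lemma face_cube_prism_1: "face (Suc n) 1 e (cube_prism n f g s) = cube_map n (if e then g else f) s"
  by (auto simp: face_def cube_prism_def cube_map_def restrict_def)

lemma face_cube_prism_Suc:
  assumes "i \<le> m"
  shows "face (Suc (Suc m)) (Suc (Suc i)) e (cube_prism (Suc m) f g s) = cube_prism m f g (face (Suc m) (Suc i) e s)"
proof
  fix a :: "bool list"
  show "face (Suc (Suc m)) (Suc (Suc i)) e (cube_prism (Suc m) f g s) a
    = cube_prism m f g (face (Suc m) (Suc i) e s) a"
    by (cases a) (auto simp: face_eq cube_prism_def insert_at_def)
qed

text \<open>The summand of index 1 has sign -1 and gives the \<open>g\<close> end minus the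
  \<open>f\<close> end; in the other summands a face of the prism is the prism of a face, with the
  opposite sign.\<close>

lemma cube_homotopy:
  "cube_boundary (Suc (Suc m)) (push (cube_prism (Suc m) f g) c)
   = push (cube_map (Suc m) g) c - push (cube_map (Suc m) f) c
     - push (cube_prism m f g) (cube_boundary (Suc m) c)"
proof (rule linear_map_eqI[where c = c
      and h = "\<lambda>c. cube_boundary (Suc (Suc m)) (push (cube_prism (Suc m) f g) c)"
      and k = "\<lambda>c. push (cube_map (Suc m) g) c - push (cube_map (Suc m) f) c
     - push (cube_prism m f g) (cube_boundary (Suc m) c)"])
  show "linear_map (\<lambda>c. cube_boundary (Suc (Suc m)) (push (cube_prism (Suc m) f g) c))"
    by (rule linear_map_compose[OF linear_map_cube_boundary linear_extension_linear])
  show "linear_map (\<lambda>c. push (cube_map (Suc m) g) c - push (cube_map (Suc m) f) c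
     - push (cube_prism m f g) (cube_boundary (Suc m) c))"
    by (rule linear_map_minus[OF linear_map_minus[OF linear_extension_linear linear_extension_linear]
          linear_map_compose[OF linear_extension_linear linear_map_cube_boundary]])
next
  fix s
  let ?d = "\<lambda>n i s. basis (face n i False s) - basis (face n i True s)"
  have "cube_boundary (Suc (Suc m)) (basis (cube_prism (Suc m) f g s))
      = scale (- 1) (?d (Suc (Suc m)) 1 (cube_prism (Suc m) f g s))
        + (\<Sum>i = 1..Suc m. scale ((- 1) ^ Suc i) (?d (Suc (Suc m)) (Suc i) (cube_prism (Suc m) f g s)))"
    unfolding cube_boundary_basis by (subst sum.atLeast_Suc_atMost) (simp_all add: sum.shift_bounds_cl_Suc_ivl del: sum.cl_ivl_Suc power_Suc)
  also have "scale (- 1) (?d (Suc (Suc m)) 1 (cube_prism (Suc m) f g s))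
      = basis (cube_map (Suc m) g s) - basis (cube_map (Suc m) f s)"
    unfolding face_cube_prism_1 by (simp add: scale_minus_left)
  also have "(\<Sum>i = 1..Suc m. scale ((- 1) ^ Suc i) (?d (Suc (Suc m)) (Suc i) (cube_prism (Suc m) f g s)))
      = (\<Sum>i = 1..Suc m. - scale ((- 1) ^ i) (push (cube_prism m f g) (?d (Suc m) i s)))"
  proof (rule sum.cong[OF refl])
    fix k assume "k \<in> {1..Suc m}"
    then obtain i where "k = Suc i" "i \<le> m" by (cases k) auto
    then show "scale ((- 1) ^ Suc k) (?d (Suc (Suc m)) (Suc k) (cube_prism (Suc m) f g s))
        = - scale ((- 1) ^ k) (push (cube_prism m f g) (?d (Suc m) k s))"
      by (simp add: face_cube_prism_Suc linear_map_diff scale_sign_Suc del: power_Suc)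
  qed
  also have "\<dots> = - push (cube_prism m f g) (cube_boundary (Suc m) (basis s))"
    unfolding cube_boundary_basis by (simp add: linear_map_sum linear_map_scale sum_negf del: sum.cl_ivl_Suc power_Suc)
  finally show "cube_boundary (Suc (Suc m)) (push (cube_prism (Suc m) f g) (basis s))
    = push (cube_map (Suc m) g) (basis s) - push (cube_map (Suc m) f) (basis s)
     - push (cube_prism m f g) (cube_boundary (Suc m) (basis s))"
    by simp
qed

section \<open>Cubical cycles under homotopy and collapse\<close>

context chordal_graph
begin

text \<open>A flip of the first coordinate passes between \<open>f\<close> and \<open>g\<close> at
  one vertex, as a homotopy step allows; any other flip is an edge of \<open>s\<close> under a
  single endomorphism.\<close>

lemma cube_prism_singular:
  assumes h: "homotopic_step G f g" and s: "s \<in> singular_cubes G n"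
  shows "cube_prism n f g s \<in> singular_cubes G (Suc n)"
  unfolding singular_cubes_iff
proof (intro conjI allI impI)
  have V: "s a \<in> pverts G" if "length a = n" for a using s that by (auto simp: singular_cubes_iff)
  show "cube_prism n f g s \<in> {a. length a = Suc n} \<rightarrow>\<^sub>E pverts G"
    using h V by (auto simp: cube_prism_def homotopic_step_def graph_endo_def)
  fix a :: "bool list" and i assume a: "length a = Suc n" "i < Suc n"
  then obtain e b where ab: "a = e # b" "length b = n" by (cases a) auto
  show "cube_prism n f g s a = cube_prism n f g s (a[i := \<not> a ! i]) \<or>
    cube_prism n f g s a \<rightarrow> cube_prism n f g s (a[i := \<not> a ! i])"
  proof (cases i)
    case 0
    have "f (s b) = g (s b) \<or> f (s b) \<rightarrow> g (s b)" using h V ab by (auto simp: homotopic_step_def)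
    then show ?thesis using ab 0 adj_sym by (auto simp: cube_prism_def)
  next
    case (Suc j)
    then have "s b = s (b[j := \<not> b ! j]) \<or> s b \<rightarrow> s (b[j := \<not> b ! j])"
      using s ab a by (auto simp: singular_cubes_iff)
    moreover have "graph_endo G (if e then g else f)" using h by (auto simp: homotopic_step_def)
    ultimately show ?thesis
      using ab Suc a by (auto simp: cube_prism_def graph_endo_def split: if_splits)
  qed
qed

text \<open>Meant for the boundary of a cycle, which in the free module is only degenerate, not
  necessarily zero. The degenerate direction moves up by one.\<close>

lemma cube_prism_degenerate:
  assumes h: "homotopic_step G f g" and s: "s \<in> degenerate_cubes G n"
  shows "cube_prism n f g s \<in> degenerate_cubes G (Suc n)"
proof -
  obtain i where i: "i < n" "\<And>a. length a = n \<Longrightarrow> s (a[i := True]) = s (a[i := False])"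
    and "s \<in> singular_cubes G n"
    using s by (auto simp: degenerate_cubes_iff)
  then have "cube_prism n f g s \<in> singular_cubes G (Suc n)" using cube_prism_singular[OF h] by simp
  moreover have "cube_prism n f g s (a[Suc i := True]) = cube_prism n f g s (a[Suc i := False])"
    if "length a = Suc n" for a
    using that i by (cases a) (auto simp: cube_prism_def)
  ultimately show ?thesis using i(1) by (auto simp: degenerate_cubes_iff)
qed

text \<open>After \<open>g\<close> no flip changes the value, so every direction is degenerate;
  positive dimension ensures that direction 0 exists.\<close>

lemma cube_map_collapse:
  assumes g: "\<forall>(u, v)\<in>parcs G. g u = g v" and h: "graph_endo G g"
    and s: "s \<in> singular_cubes G (Suc m)"
  shows "cube_map (Suc m) g s \<in> degenerate_cubes G (Suc m)"
proof -
  have flip: "g (s a) = g (s (a[i := \<not> a ! i]))" if "length a = Suc m" "i < Suc m" for a i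
    using s that g by (fastforce simp: singular_cubes_iff)
  have "g (s (a[0 := True])) = g (s (a[0 := False]))" if "length a = Suc m" for a
    using flip[of "a[0 := True]" 0] that by simp
  then have "cube_map (Suc m) g s (a[0 := True]) = cube_map (Suc m) g s (a[0 := False])"
    if "length a = Suc m" for a using that by (simp add: cube_map_def)
  moreover have "cube_map (Suc m) g s \<in> singular_cubes G (Suc m)"
    unfolding singular_cubes_iff
  proof (intro conjI allI impI disjI1)
    show "cube_map (Suc m) g s \<in> {a. length a = Suc m} \<rightarrow>\<^sub>E pverts G"
      using s h by (auto simp: singular_cubes_iff cube_map_def graph_endo_def)
    fix a :: "bool list" and i assume "length a = Suc m" "i < Suc m"
    then show "cube_map (Suc m) g s a = cube_map (Suc m) g s (a[i := \<not> a ! i])"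
      using flip[of a i] by (simp add: cube_map_def)
  qed
  ultimately show ?thesis by (auto simp: degenerate_cubes_iff)
qed

text \<open>Chains whose class modulo degenerate chains is a boundary; this lets the argument work
  with representatives.\<close>

abbreviation cube_bounding :: "nat \<Rightarrow> ((bool list \<Rightarrow> 'a) \<Rightarrow>\<^sub>0 'r::{comm_ring,comm_monoid_mult}) set" where
  "cube_bounding n \<equiv> {a + b | a b. a \<in> cube_boundary (Suc n) ` chains_on (singular_cubes G (Suc n)) \<and>
     b \<in> degenerate_cube_chains G n}"

lemma submod_degenerate: "submod (degenerate_cube_chains G n)"
  by (simp add: degenerate_cube_chains_eq submod_chains_on)

lemma submod_cube_bounding: "submod (cube_bounding n)"
  by (intro submod_sums submod_image linear_map_cube_boundary submod_chains_on submod_degenerate)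

lemma cube_map_homotopic_step:
  assumes h: "homotopic_step G f g" and c: "c \<in> chains_on (singular_cubes G (Suc m))"
    and dc: "cube_boundary (Suc m) c \<in> degenerate_cube_chains G m"
  shows "push (cube_map (Suc m) f) c - push (cube_map (Suc m) g) c \<in> cube_bounding (Suc m)"
proof -
  let ?P = "push (cube_prism (Suc m) f g) c" and ?D = "push (cube_prism m f g) (cube_boundary (Suc m) c)"
  have P: "?P \<in> chains_on (singular_cubes G (Suc (Suc m)))"
    by (rule push_in_chains_on[OF c]) (rule cube_prism_singular[OF h])
  have D: "?D \<in> degenerate_cube_chains G (Suc m)"
    using dc unfolding degenerate_cube_chains_eq
    by (rule push_in_chains_on) (rule cube_prism_degenerate[OF h])
  have "push (cube_map (Suc m) g) c - push (cube_map (Suc m) f) c = cube_boundary (Suc (Suc m)) ?P + ?D"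
    by (simp add: cube_homotopy)
  then have "push (cube_map (Suc m) g) c - push (cube_map (Suc m) f) c \<in> cube_bounding (Suc m)"
    by (rule sumsI[OF _ _ D]) (rule imageI[OF P])
  from submod_uminus[OF submod_cube_bounding this] show ?thesis by simp
qed

text \<open>\<open>c\<close> is the sum of its difference from its image under the collapsing map,
  which bounds by telescoping, and that image, which is degenerate.\<close>

lemma cube_cycle_bounds:
  assumes c: "c \<in> chains_on (singular_cubes G (Suc m))"
    and dc: "cube_boundary (Suc m) c \<in> degenerate_cube_chains G m"
  shows "c \<in> cube_bounding (Suc m)"
proof -
  obtain g where g: "(homotopic_step G)\<^sup>*\<^sup>* id g" "\<forall>(u, v)\<in>parcs G. g u = g v"
    using contractible_components by blast
  have "graph_endo G g"
    using g(1) by (cases rule: rtranclp.cases) (auto simp: homotopic_step_def graph_endo_def)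
  then have "push (cube_map (Suc m) g) c \<in> degenerate_cube_chains G (Suc m)"
    unfolding degenerate_cube_chains_eq by (intro push_in_chains_on[OF c] cube_map_collapse[OF g(2)])
  moreover have "0 \<in> cube_boundary (Suc (Suc m)) ` chains_on (singular_cubes G (Suc (Suc m)))"
    by (rule submod_zero[OF submod_image[OF linear_map_cube_boundary submod_chains_on]])
  ultimately have zero: "0 + push (cube_map (Suc m) g) c \<in> cube_bounding (Suc m)"
    by (intro sumsI[OF refl])
  have diff: "push (cube_map (Suc m) id) c - push (cube_map (Suc m) g) c \<in> cube_bounding (Suc m)"
    by (rule rtranclp_difference_in_submod[where F = "\<lambda>f. push (cube_map (Suc m) f) c", OF g(1) submod_cube_bounding])
      (rule cube_map_homotopic_step[OF _ c dc])
  \<comment> \<open>Off the cube \<open>s\<close> is already \<open>undefined\<close>, so the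
    restriction in \<open>cube_map\<close> changes nothing.\<close>
  have "push (cube_map (Suc m) id) c = c"
  proof (rule linear_map_eqI[OF linear_extension_linear linear_map_id])
    fix s assume "s \<in> Poly_Mapping.keys c"
    then have "s \<in> singular_cubes G (Suc m)" using c by blast
    then have "cube_map (Suc m) id s = s"
      by (auto simp: cube_map_def singular_cubes_iff PiE_def extensional_def restrict_def)
    then show "push (cube_map (Suc m) id) (basis s) = basis s" by simp
  qed
  then show ?thesis
    using submod_add[OF submod_cube_bounding diff zero] by (simp only: add_0 diff_add_cancel)
qed

text \<open>Phrased as a one-element carrier fixed by the operations, so that modules with different
  element types can be compared by constant maps.\<close>

lemma cube_homology_trivial:
  fixes H :: "('r::{comm_ring,comm_monoid_mult}, ((bool list \<Rightarrow> 'a) \<Rightarrow>\<^sub>0 'r) set set) module"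
  assumes "n > 0"
  defines "H \<equiv> cube_homology G n"
  shows "\<exists>B. carrier H = {B} \<and> B \<oplus>\<^bsub>H\<^esub> B = B \<and> (\<forall>r. r \<odot>\<^bsub>H\<^esub> B = B)"
proof -
  obtain m where n: "n = Suc m" using assms by (cases n) auto
  let ?N = "degenerate_cube_chains G n :: ((bool list \<Rightarrow> 'a) \<Rightarrow>\<^sub>0 'r) set"
  let ?B = "cube_boundary (Suc n) ` chains_on (singular_cubes G (Suc n)) :: ((bool list \<Rightarrow> 'a) \<Rightarrow>\<^sub>0 'r) set"
  let ?Z = "cycles (cube_chain_module G) (cube_differential G) n :: ((bool list \<Rightarrow> 'a) \<Rightarrow>\<^sub>0 'r) set set"
  have N: "submod ?N" by (rule submod_degenerate)
  have B: "submod ?B" by (intro submod_image linear_map_cube_boundary submod_chains_on)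
  have d: "cube_differential G (Suc k) (coset (degenerate_cube_chains G (Suc k)) x)
      = coset (degenerate_cube_chains G k) (cube_boundary (Suc k) x)"
    for k and x :: "(bool list \<Rightarrow> 'a) \<Rightarrow>\<^sub>0 'r"
    unfolding cube_differential_def diff_Suc_1
    using cube_boundary_degenerate
    by (intro induced_map_coset linear_map_cube_boundary submod_degenerate) blast
  have car: "carrier (cube_chain_module G k)
      = coset (degenerate_cube_chains G k) ` (chains_on (singular_cubes G k) :: ((bool list \<Rightarrow> 'a) \<Rightarrow>\<^sub>0 'r) set)" for k
    by (simp add: cube_chain_module_def quotient_module_simps a_rcosets_free)
  have bd: "boundaries (cube_chain_module G) (cube_differential G) n = coset ?N ` ?B"
    unfolding boundaries_def car image_image d ..
  have zero: "\<zero>\<^bsub>cube_chain_module G k\<^esub> = degenerate_cube_chains G k" for k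
    by (simp add: cube_chain_module_def quotient_module_simps)
  \<comment> \<open>A cycle of classes is represented by a chain with degenerate boundary;
    \<open>cube_cycle_bounds\<close> writes it as a boundary plus a degenerate chain, and the latter
    disappears in the coset.\<close>
  have cyc: "?Z \<subseteq> coset ?N ` ?B"
  proof
    fix X :: "((bool list \<Rightarrow> 'a) \<Rightarrow>\<^sub>0 'r) set"
    assume "X \<in> ?Z"
    then obtain c where c: "X = coset ?N c" "c \<in> chains_on (singular_cubes G n)"
      and dX: "cube_differential G n X = degenerate_cube_chains G m"
      unfolding cycles_def car zero by (auto simp: n)
    have "cube_boundary (Suc m) c \<in> degenerate_cube_chains G m"
      using dX unfolding c(1) n d by (simp add: coset_self_iff[OF submod_degenerate])
    from cube_cycle_bounds[OF c(2)[unfolded n] this, folded n] obtain a b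
      where "c = a + b" "a \<in> ?B" "b \<in> ?N" by (elim CollectE exE conjE)
    then have "X = coset ?N a" by (simp add: c(1) coset_eq_iff[OF N])
    with \<open>a \<in> ?B\<close> show "X \<in> coset ?N ` ?B" by blast
  qed
  have "coset ?N 0 \<in> ?Z"
    unfolding cycles_def car zero
    by (simp add: n d linear_map_zero coset_self_iff[OF submod_degenerate] submod_zero[OF submod_degenerate])
  then have ne: "?Z \<noteq> {}" by blast
  have add: "X \<oplus>\<^bsub>cube_chain_module G n\<^esub> Y = set_add (free_module (singular_cubes G n)) X Y"
    for X Y :: "((bool list \<Rightarrow> 'a) \<Rightarrow>\<^sub>0 'r) set"
    by (simp add: cube_chain_module_def quotient_module_simps)
  have smult: "r \<odot>\<^bsub>cube_chain_module G n\<^esub> X = (\<Union>x\<in>X. ?N +>\<^bsub>free_module (singular_cubes G n)\<^esub>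
      (r \<odot>\<^bsub>free_module (singular_cubes G n)\<^esub> x))" for r X
    by (simp add: cube_chain_module_def quotient_module_simps)
  note T = homology_trivial[OF N B add smult bd cyc ne]
  show ?thesis unfolding H_def cube_homology_def using T by blast
qed

end

section \<open>Path homology\<close>

text \<open>
  The alternating sums for the boundary and the prism are put in recursive form, so that the
  homotopy identity becomes an induction over the tuple.
\<close>

primrec list_boundary :: "'v list \<Rightarrow> ('v list \<Rightarrow>\<^sub>0 'r::{comm_ring,comm_monoid_mult})" where
  "list_boundary [] = 0"
| "list_boundary (x # xs) = basis xs - push (Cons x) (list_boundary xs)"

text \<open>Unfolded, for entries \<open>x0\<close>, ..., \<open>xn\<close> this is the alternating
  sum over \<open>i\<close> of the tuples \<open>f x0, ..., f xi, g xi, ..., g xn\<close>, the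
  standard simplicial prism.\<close>

primrec list_prism ::
  "('v \<Rightarrow> 'w) \<Rightarrow> ('v \<Rightarrow> 'w) \<Rightarrow> 'v list \<Rightarrow> ('w list \<Rightarrow>\<^sub>0 'r::{comm_ring,comm_monoid_mult})" where
  "list_prism f g [] = 0"
| "list_prism f g (x # xs) = basis (f x # map g (x # xs)) - push (Cons (f x)) (list_prism f g xs)"

abbreviation (input) list_boundary_chain ("\<Delta>") where "\<Delta> \<equiv> linear_extension list_boundary"

lemma list_boundary_sum:
  "(list_boundary vs :: 'v list \<Rightarrow>\<^sub>0 'r::{comm_ring,comm_monoid_mult})
   = (\<Sum>i<length vs. scale ((- 1) ^ i) (basis (take i vs @ drop (Suc i) vs)))"
proof (induction vs)
  case (Cons x xs)
  define t :: "nat \<Rightarrow> 'v list \<Rightarrow>\<^sub>0 'r" where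
    "t i = basis (x # take i xs @ drop (Suc i) xs)" for i
  have "(\<Sum>i<length (x # xs). scale ((- 1) ^ i) (basis (take i (x # xs) @ drop (Suc i) (x # xs))))
      = basis xs + (\<Sum>i<length xs. scale ((- 1) ^ Suc i) (t i))"
    unfolding length_Cons t_def by (subst sum.lessThan_Suc_shift) simp
  also have "\<dots> = basis xs - (\<Sum>i<length xs. scale ((- 1) ^ i) (t i))"
    by (simp only: scale_sign_Suc sum_negf) simp
  also have "(\<Sum>i<length xs. scale ((- 1) ^ i) (t i)) = push (Cons x) (list_boundary xs)"
    by (simp add: Cons.IH linear_map_sum linear_map_scale t_def)
  finally show ?case by simp
qed simp

lemma linear_map_path_boundary: "linear_map (path_boundary n)"
proof (cases n)
  case (Suc m)
  then show ?thesis unfolding path_boundary_def by (simp del: sum.cl_ivl_Suc)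
qed (simp add: path_boundary_def linear_map_def)

text \<open>Positive degree matters: on a single vertex \<open>list_boundary\<close> gives the empty
  tuple, as in the augmented complex, while \<open>path_boundary 0\<close> is zero.\<close>

lemma path_boundary_eq:
  fixes c :: "'v list \<Rightarrow>\<^sub>0 'r::{comm_ring,comm_monoid_mult}"
  assumes "c \<in> chains_on (vertex_tuples V (Suc n))"
  shows "path_boundary (Suc n) c = \<Delta> c"
proof (rule linear_map_eqI[OF linear_map_path_boundary linear_extension_linear])
  fix vs assume "vs \<in> Poly_Mapping.keys c"
  then have len: "length vs = Suc (Suc n)" using assms by (auto simp: vertex_tuples_def)
  have "{0..Suc n} = {..<Suc (Suc n)}" by auto
  then show "path_boundary (Suc n) (basis vs :: 'v list \<Rightarrow>\<^sub>0 'r) = \<Delta> (basis vs)"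
    by (simp add: path_boundary_def list_boundary_sum len del: sum.cl_ivl_Suc sum.lessThan_Suc)
qed

lemma list_boundary_map: "list_boundary (map f xs) = push (map f) (list_boundary xs)"
  by (induction xs) (simp_all add: linear_map_zero linear_map_diff push_push)

text \<open>Prepending \<open>x\<close> is a contracting homotopy of the augmented tuple
  complex.\<close>

lemma boundary_push_Cons: "\<Delta> (push (Cons x) c) = c - push (Cons x) (\<Delta> c)"
  by (rule linear_map_eqI[OF linear_map_compose[OF linear_extension_linear linear_extension_linear]
        linear_map_minus[OF linear_map_id linear_map_compose[OF linear_extension_linear linear_extension_linear]]])
    simp

lemma prism_push_Cons:
  "linear_extension (list_prism f g) (push (Cons x) c)
   = push (Cons (f x)) (push (Cons (g x)) (push (map g) c)) - push (Cons (f x)) (linear_extension (list_prism f g) c)"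
  by (rule linear_map_eqI[OF linear_map_compose[OF linear_extension_linear linear_extension_linear]
        linear_map_minus[OF linear_map_compose[OF linear_extension_linear
            linear_map_compose[OF linear_extension_linear linear_extension_linear]]
          linear_map_compose[OF linear_extension_linear linear_extension_linear]]])
    simp

text \<open>In the recursion for \<open>x # xs\<close> the prism over \<open>xs\<close> occurs twice
  with opposite signs, and so do the tuples with \<open>f x\<close>, \<open>g x\<close> in front of
  the boundary of \<open>map g xs\<close>. What remains is two basis terms and the induction
  hypothesis with \<open>f x\<close> in front.\<close>

lemma list_homotopy:
  "(\<Delta> (list_prism f g xs) :: 'w list \<Rightarrow>\<^sub>0 'r::{comm_ring,comm_monoid_mult})
   + linear_extension (list_prism f g) (list_boundary xs) = basis (map g xs) - basis (map f xs)"
proof (induction xs)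
  case (Cons x xs)
  let ?f = "push (Cons (f x))" and ?g = "push (Cons (g x))" and ?P = "linear_extension (list_prism f g)"
  have lhs: "\<Delta> (list_prism f g (x # xs)) = basis (g x # map g xs)
      - ?f (basis (map g xs) - ?g (push (map g) (list_boundary xs)))
      - (list_prism f g xs - ?f (\<Delta> (list_prism f g xs)))"
    by (simp add: linear_map_diff boundary_push_Cons list_boundary_map)
  have rhs: "?P (list_boundary (x # xs)) = list_prism f g xs
      - (?f (?g (push (map g) (list_boundary xs))) - ?f (?P (list_boundary xs)))"
    by (simp add: linear_map_diff prism_push_Cons)
  have "(\<Delta> (list_prism f g (x # xs)) :: 'w list \<Rightarrow>\<^sub>0 'r) + ?P (list_boundary (x # xs)) =
      basis (g x # map g xs) - ?f (basis (map g xs))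
      + ?f (\<Delta> (list_prism f g xs) + ?P (list_boundary xs))"
    unfolding lhs rhs by (simp add: linear_map_diff linear_map_add)
  also have "\<dots> = basis (map g (x # xs)) - basis (map f (x # xs))"
    unfolding Cons.IH by (simp add: linear_map_diff)
  finally show ?case .
qed (simp add: linear_map_zero)

lemma path_homotopy:
  "\<Delta> (linear_extension (list_prism f g) c) + linear_extension (list_prism f g) (\<Delta> c)
   = push (map g) c - push (map f) c"
  by (rule linear_map_eqI[OF
        linear_map_plus[OF linear_map_compose[OF linear_extension_linear linear_extension_linear]
          linear_map_compose[OF linear_extension_linear linear_extension_linear]]
        linear_map_minus[OF linear_extension_linear linear_extension_linear]])
    (simp add: list_homotopy)

section \<open>Nonregular tuples under boundary and prism\<close>

lemma list_boundary_tuples: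
  "list_boundary vs \<in> chains_on {ws. Suc (length ws) = length vs \<and> set ws \<subseteq> set vs}"
proof (induction vs)
  case (Cons x xs)
  show ?case
    unfolding list_boundary.simps
    by (intro submod_diff[OF submod_chains_on] basis_in_chains_on push_in_chains_on[OF Cons.IH]) auto
qed simp

text \<open>For a repeated pair, the two faces omitting one of its entries coincide and have
  opposite signs; every other face keeps the pair.\<close>

lemma list_boundary_nonregular:
  "\<not> distinct_adj vs \<Longrightarrow>
   list_boundary vs \<in> chains_on {ws. Suc (length ws) = length vs \<and> set ws \<subseteq> set vs \<and> \<not> distinct_adj ws}"
proof (induction vs)
  case (Cons x xs)
  then obtain y zs where xs: "xs = y # zs" by (cases xs) auto
  show ?case
  proof (cases "x = y")
    case True
    have eq: "list_boundary (x # xs) = push (Cons x) (push (Cons x) (list_boundary zs))"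
      using xs True by (simp add: linear_map_diff)
    then show ?thesis
      unfolding eq push_push using xs True by (intro push_in_chains_on[OF list_boundary_tuples]) auto
  next
    case False
    then have nd: "\<not> distinct_adj xs" using Cons.prems xs by simp
    show ?thesis
      unfolding list_boundary.simps
      by (intro submod_diff[OF submod_chains_on] basis_in_chains_on push_in_chains_on[OF Cons.IH[OF nd]])
        (use nd in \<open>auto dest: distinct_adj_ConsD\<close>)
  qed
qed simp

lemma list_prism_tuples:
  assumes "\<And>x. x \<in> V \<Longrightarrow> f x \<in> V \<and> g x \<in> V"
  shows "set vs \<subseteq> V \<Longrightarrow> list_prism f g vs \<in> chains_on {ws. length ws = Suc (length vs) \<and> set ws \<subseteq> V}"
proof (induction vs)
  case (Cons x xs)
  have "set xs \<subseteq> V" using Cons.prems by simp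
  note IH = Cons.IH[OF this]
  show ?case
    unfolding list_prism.simps using Cons.prems assms
    by (intro submod_diff[OF submod_chains_on] basis_in_chains_on push_in_chains_on[OF IH]) auto
qed simp

text \<open>Unlike for the boundary, nothing has to cancel: wherever the prism switches from
  \<open>f\<close> to \<open>g\<close>, a repeated pair of \<open>vs\<close> reappears as a pair of
  \<open>f\<close> values or of \<open>g\<close> values.\<close>

lemma list_prism_nonregular:
  assumes "\<And>x. x \<in> V \<Longrightarrow> f x \<in> V \<and> g x \<in> V"
  shows "set vs \<subseteq> V \<Longrightarrow> \<not> distinct_adj vs \<Longrightarrow>
    list_prism f g vs \<in> chains_on {ws. length ws = Suc (length vs) \<and> set ws \<subseteq> V \<and> \<not> distinct_adj ws}"
proof (induction vs)
  case (Cons x xs)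
  then obtain y zs where xs: "xs = y # zs" by (cases xs) auto
  show ?case
  proof (cases "x = y")
    case True
    have eq: "list_prism f g (x # xs) = basis (f x # g x # g x # map g zs)
        - (basis (f x # f x # g x # map g zs) - push (Cons (f x)) (push (Cons (f x)) (list_prism f g zs)))"
      using xs True by (simp add: linear_map_diff)
    have zs: "set zs \<subseteq> V" and x: "f x \<in> V" "g x \<in> V" using Cons.prems xs assms by auto
    have "g ` set zs \<subseteq> V" using zs assms by auto
    then show ?thesis
      unfolding eq push_push using xs True x
      by (intro submod_diff[OF submod_chains_on] basis_in_chains_on
          push_in_chains_on[OF list_prism_tuples[OF assms zs]]) auto
  next
    case False
    then have nd: "\<not> distinct_adj xs" using Cons.prems xs by simp
    then have nd': "\<not> distinct_adj (map g xs)" by (meson distinct_adj_mapD)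
    have "set xs \<subseteq> V" using Cons.prems by simp
    note IH = Cons.IH[OF this nd]
    have x: "f x \<in> V" "g x \<in> V" "g ` set xs \<subseteq> V" using Cons.prems assms by auto
    show ?thesis
      unfolding list_prism.simps using x nd'
      by (intro submod_diff[OF submod_chains_on] basis_in_chains_on push_in_chains_on[OF IH])
        (auto dest: distinct_adj_ConsD)
  qed
qed simp

lemma nonregular_tuples_eq: "nonregular_tuples V n = {vs. length vs = Suc n \<and> set vs \<subseteq> V \<and> \<not> distinct_adj vs}"
  by (auto simp: nonregular_tuples_def vertex_tuples_def distinct_adj_conv_nth)

lemma nonregular_chains_eq: "nonregular_chains V n = chains_on (nonregular_tuples V n)"
  by (simp add: nonregular_chains_def free_module_simps)

lemma submod_nonregular: "submod (nonregular_chains V n)"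
  by (simp add: nonregular_chains_eq submod_chains_on)

lemma boundary_nonregular:
  assumes "c \<in> nonregular_chains V (Suc n)"
  shows "\<Delta> c \<in> nonregular_chains V n"
  unfolding nonregular_chains_eq
proof (rule linear_map_in_submod[OF linear_extension_linear submod_chains_on])
  show "c \<in> chains_on (nonregular_tuples V (Suc n))" using assms by (simp add: nonregular_chains_eq)
  fix vs assume "vs \<in> nonregular_tuples V (Suc n)"
  then have "length vs = Suc (Suc n)" "set vs \<subseteq> V" "\<not> distinct_adj vs" by (auto simp: nonregular_tuples_eq)
  then show "\<Delta> (basis vs) \<in> chains_on (nonregular_tuples V n)"
    using list_boundary_nonregular[of vs] by (auto simp: nonregular_tuples_eq)
qed

lemma prism_nonregular:
  assumes "\<And>x. x \<in> V \<Longrightarrow> f x \<in> V \<and> g x \<in> V" "c \<in> nonregular_chains V n"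
  shows "linear_extension (list_prism f g) c \<in> nonregular_chains V (Suc n)"
  unfolding nonregular_chains_eq
proof (rule linear_map_in_submod[OF linear_extension_linear submod_chains_on])
  show "c \<in> chains_on (nonregular_tuples V n)" using assms(2) by (simp add: nonregular_chains_eq)
  fix vs assume "vs \<in> nonregular_tuples V n"
  then have "length vs = Suc n" "set vs \<subseteq> V" "\<not> distinct_adj vs" by (auto simp: nonregular_tuples_eq)
  then show "linear_extension (list_prism f g) (basis vs) \<in> chains_on (nonregular_tuples V (Suc n))"
    using list_prism_nonregular[where V = V and f = f and g = g and vs = vs, OF assms(1)] by (auto simp: nonregular_tuples_eq)
qed

section \<open>Path cycles under homotopy and collapse\<close>

context chordal_graph
begin

lemma allowed_paths_eq:
  "allowed_paths G n = {vs. length vs = Suc n \<and> set vs \<subseteq> pverts G \<and> successively (\<rightarrow>) vs}"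
  by (auto simp: allowed_paths_def vertex_tuples_def successively_conv_nth)

text \<open>Homomorphisms may merge adjacent vertices, so a prism tuple satisfies only this weak
  condition. If no entry repeats its predecessor, all steps are arcs.\<close>

lemma weakly_allowed:
  "{vs. length vs = Suc n \<and> set vs \<subseteq> pverts G \<and> successively (\<lambda>u v. u = v \<or> u \<rightarrow> v) vs}
   \<subseteq> allowed_paths G n \<union> nonregular_tuples (pverts G) n"
proof -
  have "successively (\<rightarrow>) vs" if "successively (\<lambda>u v. u = v \<or> u \<rightarrow> v) vs" "distinct_adj vs" for vs
    using that by (induction vs rule: induct_list012) auto
  then show ?thesis by (auto simp: allowed_paths_eq nonregular_tuples_eq)
qed

text \<open>The clause on \<open>hd ws\<close> strengthens the induction: in the recursion
  \<open>f x\<close> is put in front of tuples that start with \<open>f (hd xs)\<close>, to which it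
  is equal or adjacent.\<close>

lemma list_prism_allowed:
  assumes h: "homotopic_step G f g"
  shows "vs \<noteq> [] \<Longrightarrow> set vs \<subseteq> pverts G \<Longrightarrow> successively (\<rightarrow>) vs \<Longrightarrow>
    list_prism f g vs \<in> chains_on {ws. length ws = Suc (length vs) \<and> set ws \<subseteq> pverts G \<and>
      successively (\<lambda>u v. u = v \<or> u \<rightarrow> v) ws \<and> hd ws = f (hd vs)}"
proof (induction vs rule: list_nonempty_induct)
  case (single x)
  then show ?case using h
    by (auto simp: homotopic_step_def graph_endo_def linear_map_zero)
next
  case (cons x xs)
  have xs: "set xs \<subseteq> pverts G" "successively (\<rightarrow>) xs" "x \<rightarrow> hd xs" "x \<in> pverts G"
    using cons.prems cons.hyps by (auto simp: successively_Cons)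
  note IH = cons.IH[OF xs(1,2)]
  have fg: "graph_endo G f" "graph_endo G g" "f x = g x \<or> f x \<rightarrow> g x"
    using h xs(4) by (auto simp: homotopic_step_def)
  have "successively (\<lambda>u v. u = v \<or> u \<rightarrow> v) (map g (x # xs))"
    unfolding successively_map using cons.prems(2)
    by (rule successively_mono) (use fg(2) in \<open>auto simp: graph_endo_def\<close>)
  moreover have "f x = f (hd xs) \<or> f x \<rightarrow> f (hd xs)"
    using fg(1) xs(3) by (auto simp: graph_endo_def)
  moreover have "f x \<in> pverts G" "g x \<in> pverts G" "g ` set xs \<subseteq> pverts G"
    using fg xs by (auto simp: graph_endo_def)
  ultimately show ?case
    unfolding list_prism.simps using fg(3)
    by (intro submod_diff[OF submod_chains_on] basis_in_chains_on push_in_chains_on[OF IH])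
      (auto simp: successively_Cons)
qed

lemma prism_allowed:
  assumes h: "homotopic_step G f g" and c: "c \<in> chains_on (allowed_paths G n)"
  shows "linear_extension (list_prism f g) c
    \<in> {a + b | a b. a \<in> chains_on (allowed_paths G (Suc n)) \<and> b \<in> nonregular_chains (pverts G) (Suc n)}"
proof -
  have "linear_extension (list_prism f g) c
      \<in> chains_on (allowed_paths G (Suc n) \<union> nonregular_tuples (pverts G) (Suc n))"
  proof (rule linear_map_in_submod[OF linear_extension_linear submod_chains_on c])
    fix vs assume "vs \<in> allowed_paths G n"
    then have vs: "length vs = Suc n" "vs \<noteq> []" "set vs \<subseteq> pverts G" "successively (\<rightarrow>) vs"
      by (auto simp: allowed_paths_eq)
    show "linear_extension (list_prism f g) (basis vs)
        \<in> chains_on (allowed_paths G (Suc n) \<union> nonregular_tuples (pverts G) (Suc n))"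
      using list_prism_allowed[OF h vs(2-4)] weakly_allowed[of "Suc n"] vs(1) by auto
  qed
  from subsetD[OF chains_on_Un this] show ?thesis by (simp only: nonregular_chains_eq)
qed

text \<open>The filling chain is allowed, but its boundary need not be; the membership condition of
  the path complex is restored in \<open>path_homology_trivial\<close>.\<close>

abbreviation path_bounding :: "nat \<Rightarrow> ('a list \<Rightarrow>\<^sub>0 'r::{comm_ring,comm_monoid_mult}) set" where
  "path_bounding n \<equiv> {a + b | a b. a \<in> \<Delta> ` chains_on (allowed_paths G (Suc n)) \<and>
     b \<in> nonregular_chains (pverts G) n}"

lemma submod_path_bounding: "submod (path_bounding n)"
  by (intro submod_sums submod_image linear_extension_linear submod_chains_on submod_nonregular)

lemma map_homotopic_step:
  assumes h: "homotopic_step G f g" and c: "c \<in> chains_on (allowed_paths G (Suc m))"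
    and dc: "\<Delta> c \<in> nonregular_chains (pverts G) m"
  shows "push (map f) c - push (map g) c \<in> path_bounding (Suc m)"
proof -
  let ?P = "linear_extension (list_prism f g)"
  have V: "f x \<in> pverts G \<and> g x \<in> pverts G" if "x \<in> pverts G" for x
    using h that by (auto simp: homotopic_step_def graph_endo_def)
  have D: "?P (\<Delta> c) \<in> nonregular_chains (pverts G) (Suc m)" by (rule prism_nonregular[OF V dc])
  \<comment> \<open>Only \<open>a\<close> serves as a filling; \<open>b\<close> can be split off
    because its boundary is again nonregular.\<close>
  obtain a b where ab: "?P c = a + b" "a \<in> chains_on (allowed_paths G (Suc (Suc m)))"
      "b \<in> nonregular_chains (pverts G) (Suc (Suc m))"
    using prism_allowed[OF h c, THEN CollectD] by (elim exE conjE)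
  have eq: "push (map g) c - push (map f) c = \<Delta> a + (\<Delta> b + ?P (\<Delta> c))"
    unfolding path_homotopy[symmetric] ab(1) by (simp add: linear_map_add)
  have "push (map g) c - push (map f) c \<in> path_bounding (Suc m)"
    by (rule sumsI[OF eq _ submod_add[OF submod_nonregular boundary_nonregular[OF ab(3)] D]])
      (rule imageI[OF ab(2)])
  from submod_uminus[OF submod_path_bounding this] show ?thesis by simp
qed

lemma path_cycle_bounds:
  assumes c: "c \<in> chains_on (allowed_paths G (Suc m))"
    and dc: "\<Delta> c \<in> nonregular_chains (pverts G) m"
  shows "c \<in> path_bounding (Suc m)"
proof -
  obtain g where g: "(homotopic_step G)\<^sup>*\<^sup>* id g" "\<forall>(u, v)\<in>parcs G. g u = g v"
    using contractible_components by blast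
  have endo: "graph_endo G g"
    using g(1) by (cases rule: rtranclp.cases) (auto simp: homotopic_step_def graph_endo_def)
  have "push (map g) c \<in> nonregular_chains (pverts G) (Suc m)"
    unfolding nonregular_chains_eq
  proof (rule push_in_chains_on[OF c])
    fix vs assume "vs \<in> allowed_paths G (Suc m)"
    \<comment> \<open>A path of positive degree has a first arc, and \<open>g\<close> turns it into
      a repeated entry.\<close>
    then obtain u v ws where vs: "vs = u # v # ws" "u \<rightarrow> v" "length vs = Suc (Suc m)" "set vs \<subseteq> pverts G"
      by (cases vs rule: remdups_adj.cases) (auto simp: allowed_paths_eq)
    moreover have "g u = g v" using g(2) vs(2) by auto
    ultimately show "map g vs \<in> nonregular_tuples (pverts G) (Suc m)"
      using endo by (auto simp: nonregular_tuples_eq graph_endo_def)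
  qed
  moreover have "0 \<in> \<Delta> ` chains_on (allowed_paths G (Suc (Suc m)))"
    by (rule submod_zero[OF submod_image[OF linear_extension_linear submod_chains_on]])
  ultimately have zero: "0 + push (map g) c \<in> path_bounding (Suc m)"
    by (intro sumsI[OF refl])
  have diff: "push (map id) c - push (map g) c \<in> path_bounding (Suc m)"
    by (rule rtranclp_difference_in_submod[where F = "\<lambda>f. push (map f) c", OF g(1) submod_path_bounding])
      (rule map_homotopic_step[OF _ c dc])
  have "push (map id) c = c"
    by (rule linear_map_eqI[OF linear_extension_linear linear_map_id]) simp
  then show ?thesis
    using submod_add[OF submod_path_bounding diff zero] by (simp only: add_0 diff_add_cancel)
qed

lemma path_homology_trivial:
  fixes H :: "('r::{comm_ring,comm_monoid_mult}, ('a list \<Rightarrow>\<^sub>0 'r) set set) module"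
  assumes "n > 0"
  defines "H \<equiv> path_homology G n"
  shows "\<exists>B. carrier H = {B} \<and> B \<oplus>\<^bsub>H\<^esub> B = B \<and> (\<forall>r. r \<odot>\<^bsub>H\<^esub> B = B)"
proof -
  obtain m where n: "n = Suc m" using assms by (cases n) auto
  define A where "A k = (chains_on (allowed_paths G k) :: ('a list \<Rightarrow>\<^sub>0 'r) set)" for k
  define N where "N k = (nonregular_chains (pverts G) k :: ('a list \<Rightarrow>\<^sub>0 'r) set)" for k
  \<comment> \<open>A chain in \<open>A (Suc n)\<close> represents an element of the path complex
    exactly if its boundary lies in the sum of \<open>A n\<close> and \<open>N n\<close>, so these
    are representatives of the path boundaries.\<close>
  define B where "B = \<Delta> ` A (Suc n) \<inter> {a + b | a b. a \<in> A n \<and> b \<in> N n}"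
  let ?S = "vertex_tuples (pverts G)" and ?C = "path_chain_module G" and ?d = "path_differential (pverts G)"
  let ?Z = "cycles ?C ?d n :: ('a list \<Rightarrow>\<^sub>0 'r) set set"
  have N: "submod (N k)" for k unfolding N_def by (rule submod_nonregular)
  have A: "submod (A k)" for k unfolding A_def by (rule submod_chains_on)
  have B: "submod B"
    unfolding B_def by (intro submod_Int submod_sums submod_image linear_extension_linear A N)
  have tuples: "A k \<subseteq> chains_on (?S k)" "N k \<subseteq> chains_on (?S k)" for k
    by (auto simp: A_def N_def nonregular_chains_eq nonregular_tuples_def allowed_paths_def)
  have d: "?d (Suc k) (coset (N (Suc k)) x) = coset (N k) (\<Delta> x)" if "x \<in> A (Suc k)" for k x
  proof -
    have "path_boundary (Suc k) ` N (Suc k) \<subseteq> N k"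
    proof (rule image_subsetI)
      fix y assume y: "y \<in> N (Suc k)"
      then have "path_boundary (Suc k) y = \<Delta> y" by (intro path_boundary_eq[OF subsetD[OF tuples(2)]])
      then show "path_boundary (Suc k) y \<in> N k" using boundary_nonregular y by (simp add: N_def)
    qed
    then have "?d (Suc k) (coset (N (Suc k)) x) = coset (N k) (path_boundary (Suc k) x)"
      unfolding path_differential_def diff_Suc_1 N_def[symmetric]
      by (intro induced_map_coset linear_map_path_boundary N)
    also have "path_boundary (Suc k) x = \<Delta> x"
      using that by (intro path_boundary_eq[OF subsetD[OF tuples(1)]])
    finally show ?thesis .
  qed
  have allowed: "(allowed_chains G k :: ('a list \<Rightarrow>\<^sub>0 'r) set set) = coset (N k) ` A k" for k
    by (simp add: allowed_chains_def a_r_coset_free free_module_simps N_def A_def)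
  have allowed_iff: "coset (N k) x \<in> coset (N k) ` A k \<longleftrightarrow> x \<in> {a + b | a b. a \<in> A k \<and> b \<in> N k}" for k x
  proof
    assume "coset (N k) x \<in> coset (N k) ` A k"
    then obtain a where "a \<in> A k" "x - a \<in> N k" by (auto simp: coset_eq_iff[OF N])
    then show "x \<in> {a + b | a b. a \<in> A k \<and> b \<in> N k}"
      by (intro sumsI[of _ a "x - a"]) simp_all
  next
    assume "x \<in> {a + b | a b. a \<in> A k \<and> b \<in> N k}"
    then obtain a b where "x = a + b" "a \<in> A k" "b \<in> N k" by (elim CollectE exE conjE)
    then show "coset (N k) x \<in> coset (N k) ` A k"
      by (intro image_eqI[of _ _ a]) (simp_all add: coset_eq_iff[OF N])
  qed
  have car: "carrier (?C (Suc k)) = coset (N (Suc k)) ` {x \<in> A (Suc k). \<Delta> x \<in> {a + b | a b. a \<in> A k \<and> b \<in> N k}}" for k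
  proof -
    have "carrier (?C (Suc k)) = {X \<in> coset (N (Suc k)) ` A (Suc k). ?d (Suc k) X \<in> coset (N k) ` A k}"
      by (simp add: path_chain_module_def allowed)
    also have "\<dots> = coset (N (Suc k)) ` {x \<in> A (Suc k). ?d (Suc k) (coset (N (Suc k)) x) \<in> coset (N k) ` A k}"
      by blast
    also have "{x \<in> A (Suc k). ?d (Suc k) (coset (N (Suc k)) x) \<in> coset (N k) ` A k}
        = {x \<in> A (Suc k). \<Delta> x \<in> {a + b | a b. a \<in> A k \<and> b \<in> N k}}"
      by (rule Collect_cong, rule conj_cong[OF refl]) (simp only: d allowed_iff)
    finally show ?thesis .
  qed
  have bd: "boundaries ?C ?d n = coset (N n) ` B"
  proof -
    have "boundaries ?C ?d n
        = (\<lambda>x. ?d (Suc n) (coset (N (Suc n)) x)) ` {x \<in> A (Suc n). \<Delta> x \<in> {a + b | a b. a \<in> A n \<and> b \<in> N n}}"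
      unfolding boundaries_def car image_image ..
    also have "\<dots> = (\<lambda>x. coset (N n) (\<Delta> x)) ` {x \<in> A (Suc n). \<Delta> x \<in> {a + b | a b. a \<in> A n \<and> b \<in> N n}}"
      by (rule image_cong[OF refl]) (rule d, simp)
    also have "\<dots> = coset (N n) ` B" unfolding B_def by blast
    finally show ?thesis .
  qed
  have zero: "\<zero>\<^bsub>?C k\<^esub> = N k" for k
    by (simp add: path_chain_module_def tuple_chain_module_def quotient_module_simps N_def)
  have cyc: "?Z \<subseteq> coset (N n) ` B"
  proof
    fix X :: "('a list \<Rightarrow>\<^sub>0 'r) set"
    assume "X \<in> ?Z"
    then have "X \<in> carrier (?C (Suc m))" "?d (Suc m) X = N m" unfolding cycles_def zero by (simp_all add: n)
    then obtain c where c: "X = coset (N n) c" "c \<in> A (Suc m)" and dX: "coset (N m) (\<Delta> c) = N m"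
      unfolding car using d[of _ m] by (auto simp: n)
    have "\<Delta> c \<in> N m" using dX by (simp add: coset_self_iff[OF N])
    from path_cycle_bounds[OF c(2)[unfolded A_def] this[unfolded N_def], folded n A_def N_def]
    obtain a b where ab: "c = a + b" "a \<in> \<Delta> ` A (Suc n)" "b \<in> N n"
      by (elim CollectE exE conjE)
    \<comment> \<open>The allowed chain with boundary \<open>a\<close> lies in the path complex,
      because \<open>a\<close> differs from the allowed chain \<open>c\<close> only by a nonregular
      one.\<close>
    have "a = c + (- b)" by (simp add: ab(1))
    moreover have "c \<in> A n" "- b \<in> N n" using c(2) submod_uminus[OF N ab(3)] by (simp_all add: n)
    ultimately have "a \<in> {a + b | a b. a \<in> A n \<and> b \<in> N n}" by (rule sumsI)
    moreover have "X = coset (N n) a" using ab by (simp add: c(1) coset_eq_iff[OF N])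
    ultimately show "X \<in> coset (N n) ` B" unfolding B_def using ab(2) by simp
  qed
  have "\<Delta> 0 \<in> {a + b | a b. a \<in> A m \<and> b \<in> N m}"
    unfolding linear_map_zero[OF linear_extension_linear] by (rule submod_zero[OF submod_sums[OF A N]])
  then have "coset (N n) 0 \<in> carrier (?C n)"
    unfolding n car by (intro imageI CollectI[of _ 0] conjI submod_zero[OF A])
  moreover have "?d n (coset (N n) 0) = N m"
    unfolding n d[OF submod_zero[OF A]] by (simp add: linear_map_zero coset_zero)
  ultimately have "coset (N n) 0 \<in> ?Z" unfolding cycles_def zero by (simp add: n)
  then have ne: "?Z \<noteq> {}" by blast
  have add: "X \<oplus>\<^bsub>?C n\<^esub> Y = set_add (free_module (?S n)) X Y" for X Y :: "('a list \<Rightarrow>\<^sub>0 'r) set"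
    by (simp add: path_chain_module_def tuple_chain_module_def quotient_module_simps)
  have smult: "r \<odot>\<^bsub>?C n\<^esub> X = (\<Union>x\<in>X. N n +>\<^bsub>free_module (?S n)\<^esub> (r \<odot>\<^bsub>free_module (?S n)\<^esub> x))" for r X
    by (simp add: path_chain_module_def tuple_chain_module_def quotient_module_simps N_def)
  note T = homology_trivial[OF N B add smult bd cyc ne]
  show ?thesis unfolding H_def path_homology_def using T by blast
qed

end

theorem theorem4p10:
  fixes G :: "'v pair_pre_digraph" and n :: nat
  assumes "pair_graph G" and "chordal G" and "n > 0"
  shows "module_isomorphic
           (path_homology G n ::
             ('r::{comm_ring,comm_monoid_mult}, ('v list \<Rightarrow>\<^sub>0 'r) set set) module)
           (cube_homology G n ::
             ('r, ((bool list \<Rightarrow> 'v) \<Rightarrow>\<^sub>0 'r) set set) module) \<and>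
         module_isomorphic
           (cube_homology G n ::
             ('r, ((bool list \<Rightarrow> 'v) \<Rightarrow>\<^sub>0 'r) set set) module)
           zero_module"
proof -
  interpret chordal_graph G
    using assms(1,2) by (simp add: chordal_graph_def chordal_graph_axioms_def)
  let ?P = "path_homology G n :: ('r, ('v list \<Rightarrow>\<^sub>0 'r) set set) module"
    and ?Q = "cube_homology G n :: ('r, ((bool list \<Rightarrow> 'v) \<Rightarrow>\<^sub>0 'r) set set) module"
  obtain B where B: "carrier ?P = {B}" "B \<oplus>\<^bsub>?P\<^esub> B = B" "\<And>r. r \<odot>\<^bsub>?P\<^esub> B = B"
    using path_homology_trivial[OF assms(3)] by blast
  obtain B' where B': "carrier ?Q = {B'}" "B' \<oplus>\<^bsub>?Q\<^esub> B' = B'" "\<And>r. r \<odot>\<^bsub>?Q\<^esub> B' = B'"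
    using cube_homology_trivial[OF assms(3)] by blast
  have "module_isomorphic ?P ?Q"
    unfolding module_isomorphic_def by (rule exI[of _ "\<lambda>_. B'"]) (simp add: B B' bij_betw_def)
  moreover have "module_isomorphic ?Q (zero_module :: ('r, unit) module)"
    unfolding module_isomorphic_def
    by (rule exI[of _ "\<lambda>_. ()"]) (simp add: B' bij_betw_def zero_module_def)
  ultimately show ?thesis by (rule conjI)
qed

end
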